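(* Let $t>0$, let $r\ge1$ be an integer, let $i_1<\dots<i_M$ be real, let $\underline p\in\mathbb S^M$, let $\underline b=(b_2,\dots,b_{M-1})$ satisfy $-\frac{1}{i_{j+1}-i_j}<b_j<\frac{1}{i_j-i_{j-1}}$ for $j=2,\dots,M-1$, and let $\underline k=(k_2,\dots,k_{M-1})\in\mathbb R_+^{M-2}$. Set $$\mathcal A(\underline\lambda,\underline p)(j):=\mathcal G_j\Big(\frac tr,\;Q\Big(\frac tr,\underline h^{(r-1)}(\underline p,\underline\lambda),\underline\lambda\Big)\Big),\qquad j=2,\dots,M-1 .$$ Then there exists a solution $\underline\lambda\in\mathbb R_+^{M-2}$ to the equation $\underline\lambda=\mathcal A(\underline\lambda,\underline p)$ (that is, $\underline\lambda$ such that $Q(\frac tr,\underline h^{(r-1)}(\underline p,\underline\lambda),\underline\lambda)$ is defined and lies in $\mathbb S^M$, so that the right hand side makes sense, and $\lambda_j=\mathcal A(\underline\lambda,\underline p)(j)$ for $j=2,\dots,M-1$).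
   Context: Conventions: $\mathbb R_+=[0,\infty)$, $M\ge3$, $\mathbb S^M=\{(p_1,\dots,p_M):0<p_j<1,\ \sum_jp_j=1\}$; probability vectors are row vectors; $\lambda_1=\lambda_M=0$ for $\underline\lambda=(\lambda_2,\dots,\lambda_{M-1})$. Set $\widetilde k_j=(i_{j+1}-i_j)(i_j-i_{j-1})k_j$ for $2\le j\le M-1$, $\widetilde k_1=\widetilde k_M=0$; for $2\le j\le M-1$, $q_{j,j+1}=\frac{i_j-i_{j-1}}{i_{j+1}-i_{j-1}}(1+(i_{j+1}-i_j)b_j)$, $q_{j,j-1}=\frac{i_{j+1}-i_j}{i_{j+1}-i_{j-1}}(1-(i_j-i_{j-1})b_j)$. For $s>0$, $\mathcal N_s=\mathcal N_s(\underline\lambda)$ is the $M\times M$ matrix whose first and last rows are those of the identity matrix and, for $2\le j\le M-1$, $\mathcal N_{s;j,j}=1+s\lambda_j(1+\widetilde k_j)$, $\mathcal N_{s;j,j+1}=-s\lambda_jq_{j,j+1}$, $\mathcal N_{s;j,j-1}=-s\lambda_jq_{j,j-1}$, other entries $0$. Put $$\underline h(\underline p,\underline\lambda)=\frac{1}{\sum_jp_j(1+\frac tr\lambda_j\widetilde k_j)}\,\underline p\,\mathcal N_{t/r}(\underline\lambda),\qquad \underline h^{(0)}(\underline p,\underline\lambda)=\underline p,\quad \underline h^{(1)}=\underline h,\quad \underline h^{(n)}(\underline p,\underline\lambda)=\underline h(\underline h^{(n-1)}(\underline p,\underline\lambda),\underline\lambda)\ (n\ge2),$$ $$Q_j(s,\underline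 p,\underline\lambda)=\frac{p_j(1+s\widetilde k_j\lambda_j)}{\sum_{i=1}^Mp_i(1+s\widetilde k_i\lambda_i)},\qquad j=1,\dots,M.$$ Coordinate change $\underline\kappa=(\kappa_1,\dots,\kappa_M)$ (built once from the target $\underline p$): let $\delta_j=i_j-i_{j-1}$ ($2\le j\le M$); $\Pi_1=1$, $\Pi_j=\prod_{n=2}^j\frac{1-\delta_nb_n}{1+\delta_{n+1}b_n}$ ($2\le j\le M-1$). Fix $\vartheta\in(0,\frac12)$ with $e_-:=\inf\{j:\sum_{i=1}^jp_i\ge\vartheta\}<e_+:=\sup\{j:\sum_{i=j}^Mp_i\ge\vartheta\}$, let $K=(i_{e_+}-i_{e_-})\vee1$, $\epsilon_{j+1}=K\,\delta_{j+1}\Pi_j\big/\sum_{a=e_-}^{e_+-1}\delta_{a+1}\Pi_a$ ($1\le j\le M-1$). Let $e$ satisfy $\sum_{i\le e}p_i\ge\frac12$, $\sum_{i\ge e}p_i\ge\frac12$. Then $\kappa_e=0$ and $\kappa_j-\kappa_{j-1}=\epsilon_j$ for $2\le j\le M$; $\underline\kappa$ is strictly increasing and $q_{j,j+1}=\frac{\kappa_j-\kappa_{j-1}}{\kappa_{j+1}-\kappa_{j-1}}$, $q_{j,j-1}=\frac{\kappa_{j+1}-\kappa_j}{\kappa_{j+1}-\kappa_{j-1}}$. For $s>0$ and $\underline\pi\in\mathbb S^M$, $\mathcal G(s,\underline\pi)=(\mathcal G_1,\dots,\mathcal G_M)$ (nonnegative entries) is defined by the system: $\mathcal G_1=\mathcal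 G_M=0$, $$\mathcal G_j=\frac{1}{s\pi_j}\frac{\kappa_{j+1}-\kappa_{j-1}}{(\kappa_{j+1}-\kappa_j)(\kappa_j-\kappa_{j-1})}\times\begin{cases}\sum_{a=1}^{j-1}(\kappa_j-\kappa_a)\pi_a(1+s\mathcal G_a\widetilde k_a)&2\le j\le l-1\\ \sum_{a=j+1}^{M}(\kappa_a-\kappa_j)\pi_a(1+s\mathcal G_a\widetilde k_a)&l\le j\le M-1\end{cases}$$ where $l$ is the index with $\kappa_{l-1}<\frac{\sum_{j=1}^M\kappa_j\pi_j(1+s\mathcal G_j\widetilde k_j)}{\sum_{j=1}^M\pi_j(1+s\mathcal G_j\widetilde k_j)}\le\kappa_l$. *)

theory Defs
  imports "HOL-Analysis.Analysis"
begin

text \<open>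
  Vectors with entries indexed by \<open>1, \<dots>, M\<close> are functions \<open>nat \<Rightarrow> real\<close> of which only the values
  on \<open>{1..M}\<close> matter, and \<open>\<Delta> M\<close> is the open simplex of such vectors.  The data
  \<open>b\<close>, \<open>k\<close> are only used on \<open>{2..M-1}\<close>.  A vector \<open>\<lambda> = (\<lambda>\<^sub>2, \<dots>, \<lambda>\<^sub>M\<^sub>-\<^sub>1)\<close> is extended by zero, which
  includes the convention \<open>\<lambda>\<^sub>1 = \<lambda>\<^sub>M = 0\<close>.  The state space \<open>i\<^sub>1 < \<dots> < i\<^sub>M\<close> is called \<open>x\<close>.
\<close>

definition open_simplex :: "nat \<Rightarrow> (nat \<Rightarrow> real) set" (\<open>\<Delta>\<close>) where
  "\<Delta> M = {p. (\<forall>j\<in>{1..M}. 0 < p j \<and> p j < 1) \<and> (\<Sum>j=1..M. p j) = 1}"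

definition rate_vectors :: "nat \<Rightarrow> (nat \<Rightarrow> real) set" where
  "rate_vectors M = {lam. (\<forall>j\<in>{2..M-1}. 0 \<le> lam j) \<and> (\<forall>j. j \<notin> {2..M-1} \<longrightarrow> lam j = 0)}"

definition ktilde :: "nat \<Rightarrow> (nat \<Rightarrow> real) \<Rightarrow> (nat \<Rightarrow> real) \<Rightarrow> nat \<Rightarrow> real" where
  "ktilde M x k j =
     (if j \<in> {2..M-1} then (x (j+1) - x j) * (x j - x (j-1)) * k j else 0)"

text \<open>\<open>q_up x b j\<close> is $q_{j,j+1}$ and \<open>q_down x b j\<close> is $q_{j,j-1}$, for \<open>j \<in> {2..M-1}\<close>.\<close>

definition q_up :: "(nat \<Rightarrow> real) \<Rightarrow> (nat \<Rightarrow> real) \<Rightarrow> nat \<Rightarrow> real" where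
  "q_up x b j = (x j - x (j-1)) / (x (j+1) - x (j-1)) * (1 + (x (j+1) - x j) * b j)"

definition q_down :: "(nat \<Rightarrow> real) \<Rightarrow> (nat \<Rightarrow> real) \<Rightarrow> nat \<Rightarrow> real" where
  "q_down x b j = (x (j+1) - x j) / (x (j+1) - x (j-1)) * (1 - (x j - x (j-1)) * b j)"

definition Nmat ::
  "nat \<Rightarrow> (nat \<Rightarrow> real) \<Rightarrow> (nat \<Rightarrow> real) \<Rightarrow> (nat \<Rightarrow> real) \<Rightarrow> real \<Rightarrow> (nat \<Rightarrow> real) \<Rightarrow> nat \<Rightarrow> nat \<Rightarrow> real"
where
  "Nmat M x b k s lam i j =
     (if i = 1 \<or> i = M then (if j = i then 1 else 0)
      else if j = i then 1 + s * lam i * (1 + ktilde M x k i)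
      else if j = i + 1 then - s * lam i * q_up x b i
      else if j = i - 1 then - s * lam i * q_down x b i
      else 0)"

definition mass ::
  "nat \<Rightarrow> (nat \<Rightarrow> real) \<Rightarrow> (nat \<Rightarrow> real) \<Rightarrow> real \<Rightarrow> (nat \<Rightarrow> real) \<Rightarrow> (nat \<Rightarrow> real) \<Rightarrow> real" where
  "mass M x k s lam p = (\<Sum>j=1..M. p j * (1 + s * lam j * ktilde M x k j))"

text \<open>The map $\underline h$ (row vector times matrix, normalised) with \<open>s = t / r\<close>.  Its iterates
  $\underline h^{(n)}$ are \<open>(hmap M x b k s lam ^^ n) p\<close>.\<close>

definition hmap ::
  "nat \<Rightarrow> (nat \<Rightarrow> real) \<Rightarrow> (nat \<Rightarrow> real) \<Rightarrow> (nat \<Rightarrow> real) \<Rightarrow> real \<Rightarrow> (nat \<Rightarrow> real) \<Rightarrow> (nat \<Rightarrow> real) \<Rightarrow> nat \<Rightarrow> real"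
where
  "hmap M x b k s lam p j = 1 / mass M x k s lam p * (\<Sum>i=1..M. p i * Nmat M x b k s lam i j)"

definition Qvec ::
  "nat \<Rightarrow> (nat \<Rightarrow> real) \<Rightarrow> (nat \<Rightarrow> real) \<Rightarrow> real \<Rightarrow> (nat \<Rightarrow> real) \<Rightarrow> (nat \<Rightarrow> real) \<Rightarrow> nat \<Rightarrow> real" where
  "Qvec M x k s p lam j = p j * (1 + s * ktilde M x k j * lam j) / mass M x k s lam p"

text \<open>\<open>Qh_defined \<dots> n p\<close>: no denominator vanishes in $Q(s, \underline h^{(n)}(\underline p,
  \underline\lambda), \underline\lambda)$.  The maps $\underline h$ and $Q$ have the same
  denominator; the cases \<open>m < n\<close> are those of the iterates of $\underline h$, and \<open>m = n\<close> is that
  of $Q$.\<close>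

definition Qh_defined ::
  "nat \<Rightarrow> (nat \<Rightarrow> real) \<Rightarrow> (nat \<Rightarrow> real) \<Rightarrow> (nat \<Rightarrow> real) \<Rightarrow> real \<Rightarrow> (nat \<Rightarrow> real) \<Rightarrow> nat \<Rightarrow> (nat \<Rightarrow> real) \<Rightarrow> bool"
where
  "Qh_defined M x b k s lam n p \<longleftrightarrow>
     (\<forall>m\<le>n. mass M x k s lam ((hmap M x b k s lam ^^ m) p) \<noteq> 0)"

definition delta :: "(nat \<Rightarrow> real) \<Rightarrow> nat \<Rightarrow> real" where
  "delta x j = x j - x (j-1)"

definition Pi_prod :: "(nat \<Rightarrow> real) \<Rightarrow> (nat \<Rightarrow> real) \<Rightarrow> nat \<Rightarrow> real" where
  "Pi_prod x b j = (\<Prod>n=2..j. (1 - delta x n * b n) / (1 + delta x (n+1) * b n))"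

definition e_minus :: "nat \<Rightarrow> real \<Rightarrow> (nat \<Rightarrow> real) \<Rightarrow> nat" where
  "e_minus M theta p = Inf {j\<in>{1..M}. (\<Sum>i=1..j. p i) \<ge> theta}"

definition e_plus :: "nat \<Rightarrow> real \<Rightarrow> (nat \<Rightarrow> real) \<Rightarrow> nat" where
  "e_plus M theta p = Sup {j\<in>{1..M}. (\<Sum>i=j..M. p i) \<ge> theta}"

definition Kscale :: "nat \<Rightarrow> (nat \<Rightarrow> real) \<Rightarrow> real \<Rightarrow> (nat \<Rightarrow> real) \<Rightarrow> real" where
  "Kscale M x theta p = max (x (e_plus M theta p) - x (e_minus M theta p)) 1"

text \<open>\<open>epsilon \<dots> j\<close> is $\epsilon_j$ for \<open>j \<in> {2..M}\<close>.\<close>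

definition epsilon ::
  "nat \<Rightarrow> (nat \<Rightarrow> real) \<Rightarrow> (nat \<Rightarrow> real) \<Rightarrow> real \<Rightarrow> (nat \<Rightarrow> real) \<Rightarrow> nat \<Rightarrow> real" where
  "epsilon M x b theta p j =
     Kscale M x theta p * delta x j * Pi_prod x b (j-1) /
     (\<Sum>a = e_minus M theta p..<e_plus M theta p. delta x (a+1) * Pi_prod x b a)"

text \<open>The coordinates $\kappa_j$ are determined by $\kappa_e = 0$ and the increments
  $\kappa_j - \kappa_{j-1} = \epsilon_j$, see the two lemmas below.\<close>

definition kappa ::
  "nat \<Rightarrow> (nat \<Rightarrow> real) \<Rightarrow> (nat \<Rightarrow> real) \<Rightarrow> real \<Rightarrow> nat \<Rightarrow> (nat \<Rightarrow> real) \<Rightarrow> nat \<Rightarrow> real" where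
  "kappa M x b theta e p j =
     (\<Sum>n=2..j. epsilon M x b theta p n) - (\<Sum>n=2..e. epsilon M x b theta p n)"

lemma kappa_base: "kappa M x b theta e p e = 0"
  by (simp add: kappa_def)

lemma kappa_increment:
  assumes "2 \<le> j"
  shows "kappa M x b theta e p j - kappa M x b theta e p (j-1) = epsilon M x b theta p j"
proof -
  obtain m where j: "j = Suc m" "1 \<le> m"
    using assms by (cases j) auto
  then show ?thesis
    by (simp add: kappa_def)
qed

text \<open>\<open>G_system\<close> is the system of equations defining $\mathcal G(s, \underline\pi)$, for coordinates
  \<open>kap\<close> and \<open>kt = ktilde M x k\<close>.  The weighted mean of \<open>kap\<close> lies in $(\kappa_1, \kappa_M]$, so the
  index \<open>l\<close> is in \<open>{2..M}\<close>.\<close>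

definition kappa_mean ::
  "nat \<Rightarrow> (nat \<Rightarrow> real) \<Rightarrow> (nat \<Rightarrow> real) \<Rightarrow> real \<Rightarrow> (nat \<Rightarrow> real) \<Rightarrow> (nat \<Rightarrow> real) \<Rightarrow> real" where
  "kappa_mean M kap kt s \<pi> g =
     (\<Sum>j=1..M. kap j * \<pi> j * (1 + s * g j * kt j)) / (\<Sum>j=1..M. \<pi> j * (1 + s * g j * kt j))"

definition G_system ::
  "nat \<Rightarrow> (nat \<Rightarrow> real) \<Rightarrow> (nat \<Rightarrow> real) \<Rightarrow> real \<Rightarrow> (nat \<Rightarrow> real) \<Rightarrow> (nat \<Rightarrow> real) \<Rightarrow> bool" where
  "G_system M kap kt s \<pi> g \<longleftrightarrow>
     g \<in> rate_vectors M \<and>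
     (\<exists>l\<in>{2..M}.
        kap (l-1) < kappa_mean M kap kt s \<pi> g \<and> kappa_mean M kap kt s \<pi> g \<le> kap l \<and>
        (\<forall>j\<in>{2..M-1}.
           g j = 1 / (s * \<pi> j) *
             ((kap (j+1) - kap (j-1)) / ((kap (j+1) - kap j) * (kap j - kap (j-1)))) *
             (if j \<le> l - 1
              then \<Sum>a=1..j-1. (kap j - kap a) * \<pi> a * (1 + s * g a * kt a)
              else \<Sum>a=j+1..M. (kap a - kap j) * \<pi> a * (1 + s * g a * kt a))))"

text \<open>For \<open>s > 0\<close>, \<open>\<pi> \<in> \<Delta> M\<close>, \<open>kt \<ge> 0\<close> and strictly increasing \<open>kap\<close> the system has exactly
  one solution: given \<open>l\<close> it is a recursion from both ends, and the first index at which the right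
  moment about \<open>kap l\<close> does not exceed the left one is the only admissible \<open>l\<close>.\<close>

definition Gvec ::
  "nat \<Rightarrow> (nat \<Rightarrow> real) \<Rightarrow> (nat \<Rightarrow> real) \<Rightarrow> real \<Rightarrow> (nat \<Rightarrow> real) \<Rightarrow> nat \<Rightarrow> real" where
  "Gvec M kap kt s \<pi> = (THE g. G_system M kap kt s \<pi> g)"

text \<open>The map $\mathcal A(\underline\lambda, \underline p)$; the target \<open>p\<close> enters through the
  coordinates \<open>kap\<close> as well.\<close>

definition Amap ::
  "nat \<Rightarrow> (nat \<Rightarrow> real) \<Rightarrow> (nat \<Rightarrow> real) \<Rightarrow> (nat \<Rightarrow> real) \<Rightarrow> real \<Rightarrow> nat \<Rightarrow> real \<Rightarrow> nat \<Rightarrow>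
   (nat \<Rightarrow> real) \<Rightarrow> (nat \<Rightarrow> real) \<Rightarrow> nat \<Rightarrow> real"
where
  "Amap M x b k t r theta e lam p =
     Gvec M (kappa M x b theta e p) (ktilde M x k) (t / real r)
       (Qvec M x k (t / real r) ((hmap M x b k (t / real r) lam ^^ (r - 1)) p) lam)"

end

theory Submission
  imports Defs
begin

text \<open>
  Put $s = t/r$, $D = \mathrm{diag}(1 + s \lambda_j \widetilde k_j)$ and $w = Q(s, h^{(r-1)}(p, \lambda), \lambda)$.
  Testing $w \mathcal N_s$ against functions that are piecewise linear in $\kappa$ shows that
  $\lambda = \mathcal G(s, w)$ if $\mu = w \mathcal N_s$ is nonnegative and carried by two neighbouring
  states.  So it suffices to write $p$ as a multiple of
  $\mu \mathcal N_s^{-1} D^{-1} \mathcal N_s^{-(r-1)}$, the law after $r$ stages of a killed chain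
  started from $\mu$.

  The unknowns are the holding times $\tau_j = 1/\lambda_j \in [0, T]$, a position $m \in [1, M]$ that
  determines $\mu$, and the occupation times $z_{n,j}$ of each stage; taking the latter as
  unknowns avoids inverse matrices and makes everything continuous at $\tau_j = 0$.  Brouwer's theorem
  (through Kuhn's lemma) solves the variational inequality in which $\tau_j$ is driven by
  $p_j S - y_j$ and $m$ by $\sum_j \kappa_j (p_j S - y_j)$, where $y$ is the final law and $S$ its mass.
  A holding time $0$ is impossible because it gives $y_j = 0$.  Hence $y_j \le p_j S$ at all interior
  states, and equality of the masses and of the $\kappa$-means forces $y_1 \ge p_1 S$ and
  $y_M \ge p_M S$.  This excludes $\tau_j = T$ for large $T$: almost no mass would pass $j$, while $S$ is
  bounded below independently of $T$.  So all inequalities are equalities.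
\<close>

section \<open>A variational inequality on a box\<close>

lemma tendsto_coordinatewise_fun:
  fixes f :: "'a \<Rightarrow> 'i \<Rightarrow> real"
  assumes "\<And>i. ((\<lambda>n. f n i) \<longlongrightarrow> l i) F"
  shows "(f \<longlongrightarrow> l) F"
proof -
  have "limitin (product_topology (\<lambda>i. euclidean) UNIV) f l F"
    unfolding limitin_componentwise using assms by simp
  then show ?thesis
    by (simp add: euclidean_product_topology)
qed

lemma tendsto_coordinate:
  fixes f :: "'a \<Rightarrow> 'i \<Rightarrow> real"
  assumes "(f \<longlongrightarrow> l) F"
  shows "((\<lambda>n. f n i) \<longlongrightarrow> l i) F"
  using continuous_on_tendsto_compose[OF continuous_on_product_coordinates[of i] assms] by simp

lemma compact_box_fun:
  fixes lo hi :: "'i \<Rightarrow> real"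
  shows "compact {x. \<forall>i. lo i \<le> x i \<and> x i \<le> hi i}"
proof -
  have "compactin (product_topology (\<lambda>i::'i. euclidean) UNIV) (PiE UNIV (\<lambda>i. {lo i..hi i}))"
    by (subst compactin_PiE) (simp add: compact_Icc)
  then have "compact (PiE UNIV (\<lambda>i. {lo i..hi i}))"
    by (simp add: euclidean_product_topology)
  then show ?thesis by (simp add: PiE_def Pi_def)
qed

lemma box_variational_inequality:
  fixes I :: "'i::countable set" and F :: "('i \<Rightarrow> real) \<Rightarrow> 'i \<Rightarrow> real"
  assumes fin: "finite I" and lohi: "\<forall>i\<in>I. lo i \<le> hi i"
    and cont: "\<forall>i\<in>I. continuous_on {x. \<forall>i\<in>I. lo i \<le> x i \<and> x i \<le> hi i} (\<lambda>x. F x i)"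
  shows "\<exists>x. \<forall>i\<in>I. lo i \<le> x i \<and> x i \<le> hi i \<and>
    (0 < F x i \<longrightarrow> x i = hi i) \<and> (F x i < 0 \<longrightarrow> x i = lo i)"
proof -
  define n where "n = card I"
  obtain ix where ix: "bij_betw ix I {..<n}"
    using ex_bij_betw_finite_nat[OF fin] unfolding n_def atLeast0LessThan by blast
  have ixn: "ix i < n" if "i \<in> I" for i
    using bij_betwE[OF ix] that by auto
  define pt where "pt N q = (\<lambda>i. if i \<in> I then lo i + (hi i - lo i) * (real (q (ix i)) / real N) else 0)"
    for N and q :: "nat \<Rightarrow> nat"
  define inr where "inr a = inv_into I ix a" for a
  have inr: "inr (ix i) = i" if "i \<in> I" for i
    using that ix by (simp add: inr_def bij_betw_def)
  define lab where "lab N q a =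
     (if q a = 0 then 0 else if q a = N then 1 else if F (pt N q) (inr a) \<ge> 0 then 0 else (1::nat))"
    for N and q :: "nat \<Rightarrow> nat" and a
  have ptI: "lo i \<le> pt N q i \<and> pt N q i \<le> hi i" if "i \<in> I" "0 < N" "\<forall>a<n. q a \<le> N" for N q i
  proof -
    have "real (q (ix i)) / real N \<le> 1" "0 \<le> real (q (ix i)) / real N"
      using that ixn[of i] by (auto simp: divide_simps)
    then have "0 \<le> (hi i - lo i) * (real (q (ix i)) / real N)"
      "(hi i - lo i) * (real (q (ix i)) / real N) \<le> (hi i - lo i) * 1"
      using bspec[OF lohi that(1)] by (intro mult_nonneg_nonneg mult_left_mono; simp)+
    then show ?thesis using that by (simp add: pt_def)
  qed
  define cell where "cell q w \<longleftrightarrow> (\<forall>c<n. q c \<le> w c \<and> w c \<le> q c + 1)" for q w :: "nat \<Rightarrow> nat"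
  have "\<exists>q. (\<forall>a<n. q a < Suc N) \<and>
      (\<forall>a<n. \<exists>u v. cell q u \<and> cell q v \<and> lab (Suc N) u a \<noteq> lab (Suc N) v a)" for N
  proof -
    have lab: "\<forall>w. (\<forall>i<n. w i \<le> Suc N) \<longrightarrow> (\<forall>i<n. lab (Suc N) w i = 0 \<or> lab (Suc N) w i = 1)"
      "\<forall>w. (\<forall>i<n. w i \<le> Suc N) \<longrightarrow> (\<forall>i<n. w i = 0 \<longrightarrow> lab (Suc N) w i = 0)"
      "\<forall>w. (\<forall>i<n. w i \<le> Suc N) \<longrightarrow> (\<forall>i<n. w i = Suc N \<longrightarrow> lab (Suc N) w i = 1)"
      by (simp_all add: lab_def)
    show ?thesis
      unfolding cell_def by (rule kuhn_lemma[OF zero_less_Suc lab], rule exI, rule conjI, assumption)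
  qed
  then have "\<exists>q. \<forall>N. (\<forall>a<n. q N a < Suc N) \<and>
      (\<forall>a<n. \<exists>u v. cell (q N) u \<and> cell (q N) v \<and> lab (Suc N) u a \<noteq> lab (Suc N) v a)"
    by (intro choice allI)
  then obtain q where q: "\<And>N. \<forall>a<n. q N a < Suc N"
    and q2: "\<And>N a. a < n \<Longrightarrow>
      \<exists>u v. cell (q N) u \<and> cell (q N) v \<and> lab (Suc N) u a \<noteq> lab (Suc N) v a"
    by blast
  have lab01: "lab N w a = 0 \<or> lab N w a = 1" for N w a by (simp add: lab_def)
  have point: "\<exists>w. \<forall>N. cell (q N) (w N) \<and> lab (Suc N) (w N) a = l"
    if a: "a < n" and l: "l = 0 \<or> l = 1" for a l
  proof (intro choice allI)
    fix N
    obtain u v where "cell (q N) u" "cell (q N) v" "lab (Suc N) u a \<noteq> lab (Suc N) v a"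
      using q2[OF a] by blast
    then show "\<exists>w. cell (q N) w \<and> lab (Suc N) w a = l"
      using lab01[of "Suc N" u a] lab01[of "Suc N" v a] l by metis
  qed
  define X where "X N = pt (Suc N) (q N)" for N
  define C where "C = {x. \<forall>i. (if i \<in> I then lo i else 0) \<le> x i \<and> x i \<le> (if i \<in> I then hi i else 0)}"
  have "compact C" unfolding C_def by (rule compact_box_fun)
  then have "seq_compact C" by (rule compact_imp_seq_compact)
  moreover have XC: "X N \<in> C" for N
    using ptI[of _ "Suc N" "q N"] q[of N] by (auto simp: C_def X_def pt_def less_imp_le)
  ultimately obtain x \<sigma> where xC: "x \<in> C" and \<sigma>: "strict_mono \<sigma>" and lim: "(X \<circ> \<sigma>) \<longlonglongrightarrow> x"
    unfolding seq_compact_def by meson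
  have xb: "lo i \<le> x i \<and> x i \<le> hi i" if "i \<in> I" for i
  proof -
    have "(if i \<in> I then lo i else 0) \<le> x i \<and> x i \<le> (if i \<in> I then hi i else 0)"
      using xC unfolding C_def by blast
    then show ?thesis using that by simp
  qed
  define D where "D = {x. (\<forall>i\<in>I. lo i \<le> x i \<and> x i \<le> hi i)}"
  have near: "(\<lambda>N. pt (Suc (\<sigma> N)) (w (\<sigma> N))) \<longlonglongrightarrow> x"
    if w: "\<And>N. cell (q N) (w N)" for w
  proof (rule tendsto_coordinatewise_fun)
    fix i
    have X: "(\<lambda>N. X (\<sigma> N) i) \<longlonglongrightarrow> x i"
      using tendsto_coordinate[OF lim, of i] by (simp add: o_def)
    have "(\<lambda>N. pt (Suc (\<sigma> N)) (w (\<sigma> N)) i - X (\<sigma> N) i) \<longlonglongrightarrow> 0"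
    proof (cases "i \<in> I")
      case True
      have b: "norm (pt (Suc N) (w N) i - X N i) \<le> \<bar>hi i - lo i\<bar> * (1 / real (Suc N))" for N
      proof -
        have "pt (Suc N) (w N) i - X N i =
            (hi i - lo i) * ((real (w N (ix i)) - real (q N (ix i))) / real (Suc N))"
          using True unfolding X_def pt_def
          by (simp add: diff_divide_distrib right_diff_distrib del: of_nat_Suc)
        moreover have "\<bar>(real (w N (ix i)) - real (q N (ix i))) / real (Suc N)\<bar> \<le> 1 / real (Suc N)"
          using w[of N, unfolded cell_def] ixn[OF True]
          by (fastforce simp: abs_divide simp del: of_nat_Suc intro!: divide_right_mono)
        ultimately show ?thesis
          unfolding real_norm_def by (simp only: abs_mult) (intro mult_left_mono, auto)
      qed
      have "(\<lambda>N. \<bar>hi i - lo i\<bar> * (1 / real (Suc N))) \<longlonglongrightarrow> \<bar>hi i - lo i\<bar> * 0"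
        by (intro tendsto_mult tendsto_const LIMSEQ_Suc[OF lim_1_over_n])
      then have "(\<lambda>N. \<bar>hi i - lo i\<bar> * (1 / real (Suc N))) \<longlonglongrightarrow> 0" by simp
      from Lim_null_comparison[OF always_eventually[OF allI[OF b]] this]
      have "(\<lambda>N. pt (Suc N) (w N) i - X N i) \<longlonglongrightarrow> 0" .
      from LIMSEQ_subseq_LIMSEQ[OF this \<sigma>] show ?thesis unfolding o_def .
    qed (simp add: pt_def X_def)
    from tendsto_add[OF this X] show "(\<lambda>N. pt (Suc (\<sigma> N)) (w (\<sigma> N)) i) \<longlonglongrightarrow> x i" by simp
  qed
  have inD: "pt (Suc N) w \<in> D" if "cell (q N) w" for N w
  proof -
    have "\<forall>c<n. w c \<le> Suc N" using that q[of N] unfolding cell_def by (metis Suc_eq_plus1 Suc_leI order_trans)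
    then show ?thesis using ptI[of _ "Suc N" w] by (auto simp: D_def)
  qed
  have limF: "(\<lambda>N. F (pt (Suc (\<sigma> N)) (w (\<sigma> N))) i) \<longlonglongrightarrow> F x i"
    if w: "\<And>N. cell (q N) (w N)" and "i \<in> I" for w i
  proof (rule continuous_on_tendsto_compose[OF bspec[OF cont \<open>i \<in> I\<close>] near[OF w]])
    show "x \<in> {x. \<forall>i\<in>I. lo i \<le> x i \<and> x i \<le> hi i}" using xb by blast
    show "\<forall>\<^sub>F N in sequentially. pt (Suc (\<sigma> N)) (w (\<sigma> N)) \<in> {x. \<forall>i\<in>I. lo i \<le> x i \<and> x i \<le> hi i}"
      using inD w by (simp add: D_def)
  qed
  show ?thesis
  proof (rule exI[of _ x], intro ballI conjI impI)
    show "lo i \<le> x i" "x i \<le> hi i" if "i \<in> I" for i using xb[OF that] by simp_all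
  next
    fix i assume i: "i \<in> I" and F: "F x i < 0"
    obtain w where w: "\<And>N. cell (q N) (w N)" and lw: "\<And>N. lab (Suc N) (w N) (ix i) = 0"
      using point[OF ixn[OF i], of 0] by blast
    have "\<forall>\<^sub>F N in sequentially. F (pt (Suc (\<sigma> N)) (w (\<sigma> N))) i < 0"
      using limF[of w, OF w i] F by (rule order_tendstoD(2))
    then have "\<forall>\<^sub>F N in sequentially. pt (Suc (\<sigma> N)) (w (\<sigma> N)) i = lo i"
    proof eventually_elim
      case (elim N)
      have "lab (Suc (\<sigma> N)) (w (\<sigma> N)) (ix i) = 0"
        by (rule lw)
      then have "w (\<sigma> N) (ix i) = 0"
        using elim inr[OF i] by (auto simp: lab_def split: if_splits)
      then show ?case using i by (simp add: pt_def)
    qed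
    then have "(\<lambda>N. pt (Suc (\<sigma> N)) (w (\<sigma> N)) i) \<longlonglongrightarrow> lo i"
      by (rule tendsto_eventually)
    with tendsto_coordinate[OF near[of w, OF w], of i] show "x i = lo i"
      by (rule LIMSEQ_unique)
  next
    fix i assume i: "i \<in> I" and F: "0 < F x i"
    obtain w where w: "\<And>N. cell (q N) (w N)" and lw: "\<And>N. lab (Suc N) (w N) (ix i) = 1"
      using point[OF ixn[OF i], of 1] by blast
    have "\<forall>\<^sub>F N in sequentially. F (pt (Suc (\<sigma> N)) (w (\<sigma> N))) i > 0"
      using limF[of w, OF w i] F by (rule order_tendstoD(1))
    then have "\<forall>\<^sub>F N in sequentially. pt (Suc (\<sigma> N)) (w (\<sigma> N)) i = hi i"
    proof eventually_elim
      case (elim N)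
      have "lab (Suc (\<sigma> N)) (w (\<sigma> N)) (ix i) = 1"
        by (rule lw)
      then have "w (\<sigma> N) (ix i) = Suc (\<sigma> N)"
        using elim inr[OF i] by (auto simp: lab_def split: if_splits)
      then show ?case using i by (simp add: pt_def del: of_nat_Suc)
    qed
    then have "(\<lambda>N. pt (Suc (\<sigma> N)) (w (\<sigma> N)) i) \<longlonglongrightarrow> hi i"
      by (rule tendsto_eventually)
    with tendsto_coordinate[OF near[of w, OF w], of i] show "x i = hi i"
      by (rule LIMSEQ_unique)
  qed
qed

section \<open>Uniqueness for the system of equations and the coordinates\<close>

definition left_moment :: "(nat \<Rightarrow> real) \<Rightarrow> (nat \<Rightarrow> real) \<Rightarrow> nat \<Rightarrow> real" where
  "left_moment kap v j = (\<Sum>a=1..j-1. (kap j - kap a) * v a)"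

definition right_moment :: "nat \<Rightarrow> (nat \<Rightarrow> real) \<Rightarrow> (nat \<Rightarrow> real) \<Rightarrow> nat \<Rightarrow> real" where
  "right_moment M kap v j = (\<Sum>a=j+1..M. (kap a - kap j) * v a)"

lemma sum_about_eq_moments:
  assumes "j \<in> {1..M}"
  shows "(\<Sum>a=1..M. (kap a - kap j) * v a) = right_moment M kap v j - left_moment kap v j"
proof -
  have "{1..M} = {1..j-1} \<union> {j} \<union> {j+1..M}" using assms by auto
  then have "(\<Sum>a=1..M. (kap a - kap j) * v a) =
      (\<Sum>a\<in>{1..j-1} \<union> {j}. (kap a - kap j) * v a) + right_moment M kap v j"
    unfolding right_moment_def by (simp only:) (rule sum.union_disjoint, auto)
  also have "(\<Sum>a\<in>{1..j-1} \<union> {j}. (kap a - kap j) * v a) = (\<Sum>a=1..j-1. (kap a - kap j) * v a)"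
    using assms by (subst sum.union_disjoint) auto
  also have "\<dots> = - left_moment kap v j"
    unfolding left_moment_def by (simp add: sum_negf[symmetric] algebra_simps)
  finally show ?thesis by simp
qed

lemma mean_compare:
  fixes kap v :: "nat \<Rightarrow> real"
  assumes "j \<in> {1..M}" "(\<Sum>a=1..M. v a) > 0"
  shows "kap j < (\<Sum>a=1..M. kap a * v a) / (\<Sum>a=1..M. v a) \<longleftrightarrow>
           left_moment kap v j < right_moment M kap v j"
    and "(\<Sum>a=1..M. kap a * v a) / (\<Sum>a=1..M. v a) \<le> kap j \<longleftrightarrow>
           right_moment M kap v j \<le> left_moment kap v j"
proof -
  have "(\<Sum>a=1..M. kap a * v a) - kap j * (\<Sum>a=1..M. v a) =
      right_moment M kap v j - left_moment kap v j"
    using sum_about_eq_moments[OF assms(1), of kap v]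
    by (simp add: left_diff_distrib sum_subtractf sum_distrib_left)
  then show "kap j < (\<Sum>a=1..M. kap a * v a) / (\<Sum>a=1..M. v a) \<longleftrightarrow>
           left_moment kap v j < right_moment M kap v j"
    and "(\<Sum>a=1..M. kap a * v a) / (\<Sum>a=1..M. v a) \<le> kap j \<longleftrightarrow>
           right_moment M kap v j \<le> left_moment kap v j"
    using assms(2) by (auto simp: pos_less_divide_eq pos_divide_le_eq)
qed

lemma left_moment_mono:
  assumes "\<And>i j. 1 \<le> i \<Longrightarrow> i \<le> j \<Longrightarrow> j \<le> M \<Longrightarrow> kap i \<le> kap j"
    and "\<And>a. a \<in> {1..M} \<Longrightarrow> 0 \<le> v a" "i \<le> j" "j \<le> M"
  shows "left_moment kap v i \<le> left_moment kap v j"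
proof (cases "i = 0")
  case True
  have "0 \<le> left_moment kap v j"
    unfolding left_moment_def using assms by (intro sum_nonneg mult_nonneg_nonneg) auto
  then show ?thesis using True by (simp add: left_moment_def)
next
  case False
  have "left_moment kap v i \<le> (\<Sum>a=1..i-1. (kap j - kap a) * v a)"
    unfolding left_moment_def using assms False by (intro sum_mono mult_right_mono) auto
  also have "\<dots> \<le> left_moment kap v j"
    unfolding left_moment_def using assms by (intro sum_mono2 mult_nonneg_nonneg) auto
  finally show ?thesis .
qed

lemma right_moment_mono:
  assumes "\<And>i j. 1 \<le> i \<Longrightarrow> i \<le> j \<Longrightarrow> j \<le> M \<Longrightarrow> kap i \<le> kap j"
    and "\<And>a. a \<in> {1..M} \<Longrightarrow> 0 \<le> v a" "1 \<le> i" "i \<le> j" "j \<le> M"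
  shows "right_moment M kap v j \<le> right_moment M kap v i"
proof -
  have "right_moment M kap v j \<le> (\<Sum>a=j+1..M. (kap a - kap i) * v a)"
    unfolding right_moment_def using assms by (intro sum_mono mult_right_mono) auto
  also have "\<dots> \<le> right_moment M kap v i"
    unfolding right_moment_def using assms by (intro sum_mono2 mult_nonneg_nonneg) auto
  finally show ?thesis .
qed

lemma G_system_iff:
  assumes pos: "s > 0" "\<forall>j\<in>{1..M}. \<pi> j > 0" "\<forall>j\<in>{1..M}. 0 \<le> kt j" and M: "M \<ge> 1"
  shows "G_system M kap kt s \<pi> g \<longleftrightarrow> g \<in> rate_vectors M \<and>
    (\<exists>l\<in>{2..M}.
       left_moment kap (\<lambda>a. \<pi> a * (1 + s * g a * kt a)) (l-1) <
         right_moment M kap (\<lambda>a. \<pi> a * (1 + s * g a * kt a)) (l-1) \<and>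
       right_moment M kap (\<lambda>a. \<pi> a * (1 + s * g a * kt a)) l \<le>
         left_moment kap (\<lambda>a. \<pi> a * (1 + s * g a * kt a)) l \<and>
       (\<forall>j\<in>{2..M-1}. g j = 1 / (s * \<pi> j) *
          ((kap (j+1) - kap (j-1)) / ((kap (j+1) - kap j) * (kap j - kap (j-1)))) *
          (if j \<le> l - 1 then left_moment kap (\<lambda>a. \<pi> a * (1 + s * g a * kt a)) j
           else right_moment M kap (\<lambda>a. \<pi> a * (1 + s * g a * kt a)) j)))"
proof (cases "g \<in> rate_vectors M")
  case True
  let ?v = "\<lambda>a. \<pi> a * (1 + s * g a * kt a)"
  have g0: "0 \<le> g j" for j using True by (cases "j \<in> {2..M-1}") (auto simp: rate_vectors_def)
  have vpos: "?v a > 0" if "a \<in> {1..M}" for a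
    using pos(1) bspec[OF pos(2) that] bspec[OF pos(3) that] g0[of a] by (intro mult_pos_pos add_pos_nonneg mult_nonneg_nonneg) auto
  have S: "(\<Sum>a=1..M. ?v a) > 0" using M by (intro sum_pos vpos) auto
  have mean: "kappa_mean M kap kt s \<pi> g = (\<Sum>a=1..M. kap a * ?v a) / (\<Sum>a=1..M. ?v a)"
    by (simp add: kappa_mean_def mult.assoc)
  have c1: "kap (l-1) < kappa_mean M kap kt s \<pi> g \<longleftrightarrow>
        left_moment kap ?v (l-1) < right_moment M kap ?v (l-1)"
    and c2: "kappa_mean M kap kt s \<pi> g \<le> kap l \<longleftrightarrow>
        right_moment M kap ?v l \<le> left_moment kap ?v l" if "l \<in> {2..M}" for l
    unfolding mean using that by (intro mean_compare[OF _ S]; auto)+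
  show ?thesis
    unfolding G_system_def using True c1 c2
    by (simp add: left_moment_def right_moment_def mult.assoc cong: conj_cong)
qed (simp add: G_system_def)

lemma G_system_unique:
  assumes pos: "s > 0" "\<forall>j\<in>{1..M}. \<pi> j > 0" "\<forall>j\<in>{1..M}. 0 \<le> kt j" and M: "M \<ge> 1"
    and mono: "\<And>i j. 1 \<le> i \<Longrightarrow> i \<le> j \<Longrightarrow> j \<le> M \<Longrightarrow> kap i \<le> kap j"
    and "G_system M kap kt s \<pi> g" "G_system M kap kt s \<pi> g'"
  shows "g = g'"
proof -
  define v where "v g a = \<pi> a * (1 + s * g a * kt a)" for g :: "nat \<Rightarrow> real" and a
  define c where "c j = 1 / (s * \<pi> j) * ((kap (j+1) - kap (j-1)) / ((kap (j+1) - kap j) * (kap j - kap (j-1))))" for j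
  define sol where "sol g l \<longleftrightarrow> g \<in> rate_vectors M \<and> l \<in> {2..M} \<and>
       left_moment kap (v g) (l-1) < right_moment M kap (v g) (l-1) \<and>
       right_moment M kap (v g) l \<le> left_moment kap (v g) l \<and>
       (\<forall>j\<in>{2..M-1}. g j = c j *
          (if j \<le> l - 1 then left_moment kap (v g) j else right_moment M kap (v g) j))" for g l
  have sol: "\<exists>l. sol g l" if "G_system M kap kt s \<pi> g" for g
    using that unfolding G_system_iff[of s M \<pi> kt, OF pos M] sol_def v_def c_def by blast
  have le: "g = g'" if g: "sol g l" and g': "sol g' l'" and ll: "l \<le> l'" for g g' l l'
  proof -
    have rv: "g \<in> rate_vectors M" "g' \<in> rate_vectors M" and lM: "l \<in> {2..M}" "l' \<in> {2..M}"
      using g g' by (auto simp: sol_def)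
    have out: "g j = g' j" if "j \<notin> {2..M-1}" for j
      using rv that by (simp add: rate_vectors_def)
    have left: "g j = g' j" if "j \<le> l - 1" for j
      using that
    proof (induction j rule: less_induct)
      case (less j)
      show ?case
      proof (cases "j \<in> {2..M-1}")
        case True
        have "left_moment kap (v g) j = left_moment kap (v g') j"
          unfolding left_moment_def v_def using less by (intro sum.cong) auto
        moreover have "g j = c j * left_moment kap (v g) j" "g' j = c j * left_moment kap (v g') j"
          using g g' True less.prems ll by (auto simp: sol_def)
        ultimately show ?thesis by simp
      qed (rule out)
    qed
    have right: "g j = g' j" if "l' \<le> j" for j
      using that
    proof (induction "M - j" arbitrary: j rule: less_induct)
      case less
      show ?case
      proof (cases "j \<in> {2..M-1}")
        case True
        have "right_moment M kap (v g) j = right_moment M kap (v g') j"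
          unfolding right_moment_def v_def using less True by (intro sum.cong) auto
        moreover have "\<not> j \<le> l - 1" "\<not> j \<le> l' - 1" using less.prems ll lM by auto
        then have "g j = c j * right_moment M kap (v g) j" "g' j = c j * right_moment M kap (v g') j"
          using g g' True by (auto simp: sol_def)
        ultimately show ?thesis by simp
      qed (rule out)
    qed
    have "l = l'"
    proof (rule ccontr)
      assume "l \<noteq> l'"
      with ll lM have l: "l \<le> l' - 1" "l' - 1 \<le> M" "1 \<le> l" by auto
      have nonneg: "0 \<le> v h a" if "h \<in> rate_vectors M" "a \<in> {1..M}" for h a
      proof -
        have "0 \<le> h a" using that by (cases "a \<in> {2..M-1}") (auto simp: rate_vectors_def)
        then show ?thesis unfolding v_def using pos(1) bspec[OF pos(2) that(2)] bspec[OF pos(3) that(2)]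
          by (intro mult_nonneg_nonneg add_nonneg_nonneg) auto
      qed
      have "right_moment M kap (v g') (l'-1) = right_moment M kap (v g) (l'-1)"
        unfolding right_moment_def v_def using right l by (intro sum.cong) auto
      also have "\<dots> \<le> right_moment M kap (v g) l"
        using l by (intro right_moment_mono mono nonneg rv) auto
      also have "\<dots> \<le> left_moment kap (v g) l" using g by (simp add: sol_def)
      also have "\<dots> = left_moment kap (v g') l"
        unfolding left_moment_def v_def using left by (intro sum.cong) auto
      also have "\<dots> \<le> left_moment kap (v g') (l'-1)"
        using l by (intro left_moment_mono[of M] mono nonneg rv) auto
      also have "\<dots> < right_moment M kap (v g') (l'-1)" using g' by (simp add: sol_def)
      finally show False by simp
    qed
    have "g j = g' j" for j
      using left[of j] right[of j] \<open>l = l'\<close> by (cases "j \<le> l - 1") auto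
    then show ?thesis by (rule ext)
  qed
  obtain l l' where "sol g l" "sol g' l'" using sol assms(6,7) by blast
  then show ?thesis using le[of g l g' l'] le[of g' l' g l] by (cases "l \<le> l'") auto
qed

lemma kappa_increments:
  fixes M :: nat and theta :: real and x b p :: "nat \<Rightarrow> real"
  assumes M: "M \<ge> 3"
    and x: "strict_mono_on {1..M} x"
    and p: "p \<in> \<Delta> M"
    and b: "\<forall>j\<in>{2..M-1}. - 1 / (x (j+1) - x j) < b j \<and> b j < 1 / (x j - x (j-1))"
    and th: "0 < theta" "theta < 1/2" "e_minus M theta p < e_plus M theta p"
  obtains C where "C > 0" "\<And>j. j \<in> {2..M} \<Longrightarrow>
      kappa M x b theta e p j - kappa M x b theta e p (j-1) = C * (delta x j * Pi_prod x b (j-1))"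
    and "\<And>j. j \<in> {2..M} \<Longrightarrow> delta x j > 0" "\<And>j. j \<in> {1..M-1} \<Longrightarrow> Pi_prod x b j > 0"
    and "\<And>j. j \<in> {2..M-1} \<Longrightarrow> 1 - delta x j * b j > 0"
    and "\<And>j. j \<in> {2..M-1} \<Longrightarrow> 1 + delta x (j+1) * b j > 0"
proof -
  have d: "delta x j > 0" if "j \<in> {2..M}" for j
    using strict_mono_onD[OF x, of "j-1" j] that by (auto simp: delta_def)
  have b1: "1 - delta x j * b j > 0" if "j \<in> {2..M-1}" for j
  proof -
    have "b j < 1 / delta x j" "delta x j > 0" using b that d[of j] by (auto simp: delta_def)
    then show ?thesis by (simp add: pos_less_divide_eq mult.commute)
  qed
  have b2: "1 + delta x (j+1) * b j > 0" if "j \<in> {2..M-1}" for j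
  proof -
    have "- 1 / delta x (j+1) < b j" using b that by (simp add: delta_def)
    moreover have "delta x (j+1) > 0" using that by (intro d) auto
    ultimately have "- 1 < b j * delta x (j+1)" by (simp only: pos_divide_less_eq)
    then show ?thesis by (simp add: mult.commute)
  qed
  have P: "Pi_prod x b j > 0" if "j \<in> {1..M-1}" for j
    unfolding Pi_prod_def using that by (intro prod_pos divide_pos_pos ballI b1 b2) auto
  define A where "A = {j\<in>{1..M}. (\<Sum>i=1..j. p i) \<ge> theta}"
  have "M \<in> A" using M p th by (auto simp: A_def open_simplex_def)
  then have "Inf A \<in> A" by (intro Inf_nat_def1) auto
  then have em: "e_minus M theta p \<in> {1..M}" by (auto simp: A_def e_minus_def)
  define A' where "A' = {j\<in>{1..M}. (\<Sum>i=j..M. p i) \<ge> theta}"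
  have "1 \<in> A'" "finite A'" using M p th by (auto simp: A'_def open_simplex_def)
  then have "Sup A' \<in> A'" by (auto simp: Sup_nat_def)
  then have ep: "e_plus M theta p \<in> {1..M}" by (auto simp: A'_def e_plus_def)
  have S: "(\<Sum>a = e_minus M theta p..<e_plus M theta p. delta x (a+1) * Pi_prod x b a) > 0" (is "?S > 0")
    using em ep th(3) by (intro sum_pos mult_pos_pos d P) auto
  have K: "Kscale M x theta p > 0" unfolding Kscale_def by (simp add: less_max_iff_disj)
  show thesis
  proof (rule that[of "Kscale M x theta p / ?S"])
    show "kappa M x b theta e p j - kappa M x b theta e p (j-1) =
        Kscale M x theta p / ?S * (delta x j * Pi_prod x b (j-1))" if "j \<in> {2..M}" for j
      using that by (subst kappa_increment) (auto simp: epsilon_def)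
  qed (use S K d P b1 b2 in auto)
qed

lemma kappa_strict_mono_and_q:
  fixes M e :: nat and theta :: real and x b p :: "nat \<Rightarrow> real"
  defines "kap \<equiv> kappa M x b theta e p"
  assumes "M \<ge> 3"
    and "strict_mono_on {1..M} x"
    and "p \<in> \<Delta> M"
    and "\<forall>j\<in>{2..M-1}. - 1 / (x (j+1) - x j) < b j \<and> b j < 1 / (x j - x (j-1))"
    and "0 < theta" "theta < 1/2" "e_minus M theta p < e_plus M theta p"
  shows "\<And>j. j \<in> {2..M} \<Longrightarrow> kap (j-1) < kap j"
    and "\<And>j. j \<in> {2..M-1} \<Longrightarrow> q_up x b j = (kap j - kap (j-1)) / (kap (j+1) - kap (j-1))"
    and "\<And>j. j \<in> {2..M-1} \<Longrightarrow> q_down x b j = (kap (j+1) - kap j) / (kap (j+1) - kap (j-1))"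
proof -
  obtain C where C: "C > 0" and inc: "\<And>j. j \<in> {2..M} \<Longrightarrow>
      kap j - kap (j-1) = C * (delta x j * Pi_prod x b (j-1))"
    and d: "\<And>j. j \<in> {2..M} \<Longrightarrow> delta x j > 0" and P: "\<And>j. j \<in> {1..M-1} \<Longrightarrow> Pi_prod x b j > 0"
    and b1: "\<And>j. j \<in> {2..M-1} \<Longrightarrow> 1 - delta x j * b j > 0"
    and b2: "\<And>j. j \<in> {2..M-1} \<Longrightarrow> 1 + delta x (j+1) * b j > 0"
    using kappa_increments[OF assms(2-8), of e] unfolding kap_def by blast
  show "kap (j-1) < kap j" if j: "j \<in> {2..M}" for j
  proof -
    have "C * (delta x j * Pi_prod x b (j-1)) > 0"
      using j by (intro mult_pos_pos C d[OF j] P) auto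
    then show ?thesis using inc[OF j] by linarith
  qed
  fix j assume j: "j \<in> {2..M-1}"
  define A where "A = C * Pi_prod x b (j-1)"
  define d1 where "d1 = delta x j"
  define d2 where "d2 = delta x (j+1)"
  define D where "D = 1 + d2 * b j"
  have A: "A > 0" "d1 > 0" "d2 > 0" "D > 0" "1 - d1 * b j > 0"
    unfolding A_def d1_def d2_def D_def using j by (intro mult_pos_pos C P d b1 b2; auto)+
  obtain m where m: "j = Suc m" "1 \<le> m" using j by (cases j) auto
  have "Pi_prod x b j = Pi_prod x b (j-1) * ((1 - d1 * b j) / D)"
    using m by (simp add: Pi_prod_def d1_def d2_def D_def)
  then have i2: "kap (j+1) - kap j = A * d2 * ((1 - d1 * b j) / D)"
  proof -
    have "kap (j+1) - kap j = C * (d2 * Pi_prod x b j)"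
      using inc[of "j+1"] j unfolding d2_def by fastforce
    then show ?thesis by (simp only: \<open>Pi_prod x b j = _\<close> A_def mult_ac)
  qed
  have i1: "kap j - kap (j-1) = A * d1"
    using inc[of j] j unfolding A_def d1_def by fastforce
  have i3: "kap (j+1) - kap (j-1) = A * (d1 + d2) / D"
  proof -
    have "kap (j+1) - kap (j-1) = A * d2 * ((1 - d1 * b j) / D) + A * d1"
      using i1 i2 by linarith
    also have "\<dots> = (A * d2 * (1 - d1 * b j) + A * d1 * D) / D"
      using A by (simp add: field_simps)
    also have "A * d2 * (1 - d1 * b j) + A * d1 * D = A * (d1 + d2)"
      by (simp add: D_def algebra_simps)
    finally show ?thesis .
  qed
  have nz: "A \<noteq> 0" "d1 + d2 \<noteq> 0" "D \<noteq> 0" using A by auto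
  have x3: "x (j+1) - x (j-1) = d1 + d2" "x j - x (j-1) = d1" "x (j+1) - x j = d2"
    by (simp_all add: d1_def d2_def delta_def)
  show "q_up x b j = (kap j - kap (j-1)) / (kap (j+1) - kap (j-1))"
    unfolding q_up_def x3 i1 i3 D_def[symmetric] using nz by simp
  show "q_down x b j = (kap (j+1) - kap j) / (kap (j+1) - kap (j-1))"
    unfolding q_down_def x3 i2 i3 using nz by simp
qed

section \<open>Killed chains on a line\<close>

locale killed_chain =
  fixes M :: nat and s :: real and kap qu qd kt :: "nat \<Rightarrow> real"
  assumes M: "M \<ge> 3" and s: "s > 0"
    and kt_nonneg: "\<And>j. 0 \<le> kt j" and kt_outside: "\<And>j. j \<notin> {2..M-1} \<Longrightarrow> kt j = 0"
    and kap_less: "\<And>j. j \<in> {2..M} \<Longrightarrow> kap (j-1) < kap j"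
    and qu: "\<And>j. j \<in> {2..M-1} \<Longrightarrow> qu j = (kap j - kap (j-1)) / (kap (j+1) - kap (j-1))"
    and qd: "\<And>j. j \<in> {2..M-1} \<Longrightarrow> qd j = (kap (j+1) - kap j) / (kap (j+1) - kap (j-1))"
begin

lemma kap_mono: "1 \<le> i \<Longrightarrow> i \<le> j \<Longrightarrow> j \<le> M \<Longrightarrow> kap i \<le> kap j"
proof (induction j)
  case (Suc j)
  show ?case
  proof (cases "i = Suc j")
    case False
    with Suc have "kap i \<le> kap j" "kap j < kap (Suc j)"
      using kap_less[of "Suc j"] by auto
    then show ?thesis by simp
  qed simp
qed simp

lemma kap_strict: "1 \<le> i \<Longrightarrow> i < j \<Longrightarrow> j \<le> M \<Longrightarrow> kap i < kap j"
  using kap_less[of j] kap_mono[of i "j-1"] by (cases j) auto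

lemma kap_interior:
  assumes "j \<in> {2..M-1}"
  shows "kap (j-1) < kap j" "kap j < kap (j+1)" "kap (j-1) < kap (j+1)"
proof -
  have "1 \<le> j - 1" "j - 1 < j" "j \<le> M" "j + 1 \<le> M" "j < j + 1" "1 \<le> j" "j - 1 < j + 1"
    using assms by auto
  then show "kap (j-1) < kap j" "kap j < kap (j+1)" "kap (j-1) < kap (j+1)"
    by (blast intro: kap_strict)+
qed

lemma qu_pos: "j \<in> {2..M-1} \<Longrightarrow> 0 < qu j"
  using kap_interior[of j] by (simp add: qu)

lemma qd_pos: "j \<in> {2..M-1} \<Longrightarrow> 0 < qd j"
  using kap_interior[of j] by (simp add: qd)

lemma qu_qd: "j \<in> {2..M-1} \<Longrightarrow> qu j + qd j = 1"
  using kap_interior[of j] by (simp add: qu qd add_divide_distrib[symmetric])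

lemma q_le_1: "j \<in> {2..M-1} \<Longrightarrow> qu j \<le> 1" "j \<in> {2..M-1} \<Longrightarrow> qd j \<le> 1"
  using qu_qd[of j] qu_pos[of j] qd_pos[of j] by linarith+

text \<open>The row vector \<open>z (1 + kt - q)\<close>; thus \<open>w\<close> times the matrix $\mathcal N_s$ is
  \<open>w + s * gen (\<lambda> w)\<close>.\<close>

definition gen :: "(nat \<Rightarrow> real) \<Rightarrow> nat \<Rightarrow> real" where
  "gen z j = (1 + kt j) * z j - qu (j-1) * z (j-1) - qd (j+1) * z (j+1)"

lemma sum_interior:
  assumes "\<And>j. j \<notin> {2..M-1} \<Longrightarrow> f j = (0::real)"
  shows "sum f {1..M} = sum f {2..M-1}"
  using assms M by (intro sum.mono_neutral_right) auto

lemma sum_mult_indicator: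
  assumes "j \<in> {2..M-1}"
  shows "(\<Sum>i=2..M-1. z i * (if i = j then 1 else 0)) = (z j :: real)"
proof -
  have "(\<Sum>i=2..M-1. z i * (if i = j then 1 else 0)) = (\<Sum>i=2..M-1. if i = j then z i else 0)"
    by (rule sum.cong) auto
  also have "\<dots> = z j" using assms by (subst sum.delta) auto
  finally show ?thesis .
qed

lemma gen_duality:
  assumes z: "\<And>j. j \<notin> {2..M-1} \<Longrightarrow> z j = 0"
  shows "(\<Sum>j=1..M. f j * gen z j) =
    (\<Sum>j=2..M-1. z j * ((1 + kt j) * f j - qu j * f (j+1) - qd j * f (j-1)))"
proof -
  have up: "(\<Sum>j=1..M. f j * (qu (j-1) * z (j-1))) = (\<Sum>j=2..M-1. z j * (qu j * f (j+1)))"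
  proof -
    have "(\<Sum>j=1..M. f j * (qu (j-1) * z (j-1))) = (\<Sum>j=0..M-1. f (Suc j) * (qu j * z j))"
      using M sum.shift_bounds_cl_Suc_ivl[of "\<lambda>j. f j * (qu (j-1) * z (j-1))" 0 "M-1"] by simp
    also have "\<dots> = (\<Sum>j=2..M-1. f (Suc j) * (qu j * z j))"
      using z by (intro sum.mono_neutral_right) auto
    finally show ?thesis by (simp add: mult_ac)
  qed
  have down: "(\<Sum>j=1..M. f j * (qd (j+1) * z (j+1))) = (\<Sum>j=2..M-1. z j * (qd j * f (j-1)))"
  proof -
    have "(\<Sum>j=1..M. f j * (qd (j+1) * z (j+1))) = (\<Sum>j=Suc 1..Suc M. f (j-1) * (qd j * z j))"
      by (subst sum.shift_bounds_cl_Suc_ivl) simp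
    also have "\<dots> = (\<Sum>j=2..M-1. f (j-1) * (qd j * z j))"
      using z by (intro sum.mono_neutral_right) auto
    finally show ?thesis by (simp add: mult_ac)
  qed
  have mid: "(\<Sum>j=1..M. f j * ((1 + kt j) * z j)) = (\<Sum>j=2..M-1. z j * ((1 + kt j) * f j))"
    using sum_interior[of "\<lambda>j. f j * ((1 + kt j) * z j)"] z by (simp add: mult_ac)
  have "(\<Sum>j=1..M. f j * gen z j) = (\<Sum>j=1..M. f j * ((1 + kt j) * z j))
      - (\<Sum>j=1..M. f j * (qu (j-1) * z (j-1))) - (\<Sum>j=1..M. f j * (qd (j+1) * z (j+1)))"
    by (simp only: gen_def right_diff_distrib sum_subtractf)
  then show ?thesis
    unfolding up down mid by (simp add: sum_subtractf[symmetric] right_diff_distrib)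
qed

text \<open>One stage: the law \<open>y\<close> becomes \<open>y'\<close> while the occupation times are \<open>z\<close>.  The lower bound
  leaves room for the extra killing by $D^{-1}$ in the first stage.\<close>

definition step :: "(nat \<Rightarrow> real) \<Rightarrow> (nat \<Rightarrow> real) \<Rightarrow> (nat \<Rightarrow> real) \<Rightarrow> bool" where
  "step y z y' \<longleftrightarrow> (\<forall>j. 0 \<le> z j) \<and> (\<forall>j. j \<notin> {2..M-1} \<longrightarrow> z j = 0) \<and>
     (\<forall>j\<in>{1..M}. 0 \<le> y' j \<and> y' j \<le> y j - s * gen z j \<and>
        y j - s * gen z j - s * kt j * z j \<le> y' j)"

lemma step_test_le:
  assumes st: "step y z y'" and f: "\<And>j. j \<in> {1..M} \<Longrightarrow> 0 \<le> f j"
    and g: "\<And>j. j \<in> {2..M-1} \<Longrightarrow> - g j \<le> (1 + kt j) * f j - qu j * f (j+1) - qd j * f (j-1)"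
  shows "(\<Sum>j=1..M. f j * y' j) \<le> (\<Sum>j=1..M. f j * y j) + s * (\<Sum>j=2..M-1. z j * g j)"
proof -
  have "(\<Sum>j=1..M. f j * y' j) \<le> (\<Sum>j=1..M. f j * (y j - s * gen z j))"
    using st f by (intro sum_mono mult_left_mono) (auto simp: step_def)
  also have "\<dots> = (\<Sum>j=1..M. f j * y j) - s * (\<Sum>j=1..M. f j * gen z j)"
    by (simp add: right_diff_distrib sum_subtractf sum_distrib_left mult_ac)
  finally have "(\<Sum>j=1..M. f j * y' j) \<le> (\<Sum>j=1..M. f j * y j) - s * (\<Sum>j=1..M. f j * gen z j)" .
  moreover have "(\<Sum>j=2..M-1. z j * - g j) \<le> (\<Sum>j=1..M. f j * gen z j)"
  proof -
    have z: "0 \<le> z j" "j \<notin> {2..M-1} \<Longrightarrow> z j = 0" for j using st by (auto simp: step_def)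
    show ?thesis
      by (subst gen_duality[OF z(2)], assumption, intro sum_mono mult_left_mono g z(1))
  qed
  then have "- (s * (\<Sum>j=1..M. f j * gen z j)) \<le> s * (\<Sum>j=2..M-1. z j * g j)"
    using mult_left_mono[of "\<Sum>j=2..M-1. z j * - g j" "\<Sum>j=1..M. f j * gen z j" s] s
    by (simp add: sum_negf)
  ultimately show ?thesis by simp
qed

lemma step_mass:
  assumes "step y z y'"
  shows "(\<Sum>j=1..M. y' j) \<le> (\<Sum>j=1..M. y j)"
  using step_test_le[OF assms, of "\<lambda>_. 1" "\<lambda>_. 0"] kt_nonneg qu_qd
  by (simp add: algebra_simps)

lemma step_left:
  assumes st: "step y z y'" and j: "j \<in> {2..M-1}"
  shows "(\<Sum>i=1..j-1. y' i) \<le> (\<Sum>i=1..j-1. y i) + s * z j"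
proof -
  define f where "f i = (if i < j then 1 else 0 :: real)" for i
  have sf: "(\<Sum>i=1..j-1. v i) = (\<Sum>i=1..M. f i * v i)" for v :: "nat \<Rightarrow> real"
    using j by (simp add: f_def if_distrib[of "\<lambda>u. u * _"] sum.If_cases cong: if_cong)
      (intro sum.cong, auto)
  have "- (if i = j then 1 else 0) \<le> (1 + kt i) * f i - qu i * f (i+1) - qd i * f (i-1)"
    if i: "i \<in> {2..M-1}" for i
  proof -
    consider "i + 1 < j" | "i + 1 = j" | "i = j" | "i > j" by linarith
    then show ?thesis
      using kt_nonneg[of i] qu_qd[OF i] q_le_1[OF i] i by cases (auto simp: f_def)
  qed
  from step_test_le[OF st _ this]
  have "(\<Sum>i=1..M. f i * y' i) \<le> (\<Sum>i=1..M. f i * y i) + s * (\<Sum>i=2..M-1. z i * (if i = j then 1 else 0))"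
    by (simp add: f_def)
  also have "(\<Sum>i=2..M-1. z i * (if i = j then 1 else 0)) = z j"
    by (rule sum_mult_indicator[OF j])
  finally show ?thesis unfolding sf .
qed

lemma step_right:
  assumes st: "step y z y'" and j: "j \<in> {2..M-1}"
  shows "(\<Sum>i=j+1..M. y' i) \<le> (\<Sum>i=j+1..M. y i) + s * z j"
proof -
  define f where "f i = (if j < i then 1 else 0 :: real)" for i
  have sf: "(\<Sum>i=j+1..M. v i) = (\<Sum>i=1..M. f i * v i)" for v :: "nat \<Rightarrow> real"
    using j by (simp add: f_def if_distrib[of "\<lambda>u. u * _"] sum.If_cases cong: if_cong)
      (intro sum.cong, auto)
  have "- (if i = j then 1 else 0) \<le> (1 + kt i) * f i - qu i * f (i+1) - qd i * f (i-1)"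
    if i: "i \<in> {2..M-1}" for i
  proof -
    consider "i < j" | "i = j" | "i = j + 1" | "i > j + 1" by linarith
    then show ?thesis
      using kt_nonneg[of i] qu_qd[OF i] q_le_1[OF i] i by cases (auto simp: f_def)
  qed
  from step_test_le[OF st _ this]
  have "(\<Sum>i=1..M. f i * y' i) \<le> (\<Sum>i=1..M. f i * y i) + s * (\<Sum>i=2..M-1. z i * (if i = j then 1 else 0))"
    by (simp add: f_def)
  also have "(\<Sum>i=2..M-1. z i * (if i = j then 1 else 0)) = z j"
    by (rule sum_mult_indicator[OF j])
  finally show ?thesis unfolding sf .
qed

lemma small_ratio:
  obtains \<eta> where "0 < \<eta>" "\<eta> \<le> 1" "\<And>j. j \<in> {2..M-1} \<Longrightarrow> \<eta> * (2 + 2 * kt j) \<le> qu j"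
proof
  let ?A = "(\<lambda>j. qu j / (2 + 2 * kt j)) ` {2..M-1}"
  let ?e = "Min ?A"
  have ne: "?A \<noteq> {}" "finite ?A" using M by auto
  have pos: "2 + 2 * kt j > 0" for j using kt_nonneg[of j] by simp
  show "0 < ?e" using ne pos qu_pos by (subst Min_gr_iff) auto
  show le: "?e * (2 + 2 * kt j) \<le> qu j" if "j \<in> {2..M-1}" for j
  proof -
    have "?e \<le> qu j / (2 + 2 * kt j)" using that by (intro Min_le) auto
    then show ?thesis using pos[of j] by (simp only: pos_le_divide_eq)
  qed
  have "?e * 1 \<le> ?e * (2 + 2 * kt 2)"
    using \<open>0 < ?e\<close> kt_nonneg[of 2] by (intro mult_left_mono) auto
  also have "\<dots> \<le> qu 2" using M by (intro le) auto
  also have "\<dots> \<le> 1" using M by (intro q_le_1) auto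
  finally show "?e \<le> 1" by simp
qed

end

locale killed_chain_ratio = killed_chain +
  fixes \<eta> :: real
  assumes \<eta>: "0 < \<eta>" "\<eta> \<le> 1" and \<eta>_qu: "\<And>j. j \<in> {2..M-1} \<Longrightarrow> \<eta> * (2 + 2 * kt j) \<le> qu j"
begin

lemma ratio_power:
  assumes "j \<in> {2..M-1}"
  shows "\<eta> ^ (M - j) * (2 + 2 * kt j) \<le> qu j * \<eta> ^ (M - (j+1))"
proof -
  have "M - j = Suc (M - (j+1))" using assms by auto
  then show ?thesis
    using mult_right_mono[OF \<eta>_qu[OF assms], of "\<eta> ^ (M - (j+1))"] \<eta> by (simp add: mult_ac)
qed

lemma ratio_power_ge: "\<eta> ^ M \<le> \<eta> ^ (M - j)"
  using \<eta> by (intro power_decreasing) auto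

text \<open>The weights $\eta^{M-j}$ grow so fast towards \<open>M\<close> that moving up outweighs all killing, including
  that by $D^{-1}$.  Hence the bound on the surviving mass does not depend on the holding times.\<close>

lemma step_survival:
  assumes st: "step y z y'"
  shows "(\<Sum>j=1..M. \<eta> ^ (M - j) * y j) \<le> (\<Sum>j=1..M. \<eta> ^ (M - j) * y' j)"
proof -
  let ?f = "\<lambda>j. \<eta> ^ (M - j)"
  have f0: "0 \<le> ?f j" for j using \<eta> by simp
  have "(\<Sum>j=1..M. ?f j * gen z j) =
      (\<Sum>j=2..M-1. z j * ((1 + kt j) * ?f j - qu j * ?f (j+1) - qd j * ?f (j-1)))"
    using st by (intro gen_duality) (auto simp: step_def)
  also have "\<dots> \<le> (\<Sum>j=2..M-1. z j * (- kt j * ?f j))"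
  proof (intro sum_mono mult_left_mono)
    fix j assume j: "j \<in> {2..M-1}"
    have "0 \<le> qd j * ?f (j-1)" using f0 qd_pos[OF j] by simp
    then show "(1 + kt j) * ?f j - qu j * ?f (j+1) - qd j * ?f (j-1) \<le> - kt j * ?f j"
      using ratio_power[OF j] f0[of j] by (simp add: algebra_simps)
  qed (use st in \<open>auto simp: step_def\<close>)
  also have "\<dots> = (\<Sum>j=1..M. ?f j * (- kt j * z j))"
    using sum_interior[of "\<lambda>j. ?f j * (- kt j * z j)"] kt_outside
    by (simp add: mult_ac)
  finally have "s * (\<Sum>j=1..M. ?f j * gen z j) \<le> s * (\<Sum>j=1..M. ?f j * (- kt j * z j))"
    using s by (intro mult_left_mono) auto
  then have "0 \<le> (\<Sum>j=1..M. ?f j * (- s * gen z j - s * kt j * z j))"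
    by (simp add: sum_distrib_left sum_subtractf sum_negf algebra_simps)
  moreover have "(\<Sum>j=1..M. ?f j * (y j - s * gen z j - s * kt j * z j)) =
      (\<Sum>j=1..M. ?f j * y j) + (\<Sum>j=1..M. ?f j * (- s * gen z j - s * kt j * z j))"
    unfolding sum.distrib[symmetric] by (rule sum.cong) (auto simp: algebra_simps)
  ultimately have "(\<Sum>j=1..M. ?f j * y j) \<le> (\<Sum>j=1..M. ?f j * (y j - s * gen z j - s * kt j * z j))"
    by simp
  also have "\<dots> \<le> (\<Sum>j=1..M. ?f j * y' j)"
    using st f0 by (intro sum_mono mult_left_mono) (auto simp: step_def)
  finally show ?thesis .
qed

lemma occupation_bound:
  assumes z: "\<And>j. 0 \<le> z j" "\<And>j. j \<notin> {2..M-1} \<Longrightarrow> z j = 0"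
    and y: "\<And>j. j \<in> {1..M} \<Longrightarrow> 0 \<le> y j" "\<And>j. j \<in> {1..M} \<Longrightarrow> 0 \<le> y j - s * gen z j"
  shows "s * \<eta> ^ M * (\<Sum>j=2..M-1. z j) \<le> (\<Sum>j=2..M-1. y j)"
proof -
  define f where "f j = (if j \<in> {2..M-1} then 1 - \<eta> ^ (M - j) else 0)" for j
  have f: "0 \<le> f j" "f j \<le> 1" "f j \<le> 1 - \<eta> ^ (M - j)" for j
    using \<eta> by (auto simp: f_def power_le_one)
  have "0 \<le> (\<Sum>j=1..M. f j * (y j - s * gen z j))"
    using f y(2) by (intro sum_nonneg mult_nonneg_nonneg) auto
  also have "\<dots> = (\<Sum>j=1..M. f j * y j) - s * (\<Sum>j=1..M. f j * gen z j)"
    by (simp add: right_diff_distrib sum_subtractf sum_distrib_left mult_ac)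
  finally have 1: "s * (\<Sum>j=1..M. f j * gen z j) \<le> (\<Sum>j=1..M. f j * y j)" by simp
  have "(\<Sum>j=1..M. f j * y j) = (\<Sum>j=2..M-1. f j * y j)"
    by (rule sum_interior) (auto simp: f_def)
  also have "\<dots> \<le> (\<Sum>j=2..M-1. 1 * y j)"
    using f y(1) by (intro sum_mono mult_right_mono) auto
  finally have 2: "(\<Sum>j=1..M. f j * y j) \<le> (\<Sum>j=2..M-1. y j)" by simp
  have "(\<Sum>j=2..M-1. z j * \<eta> ^ M) \<le> (\<Sum>j=1..M. f j * gen z j)"
  proof (subst gen_duality[OF z(2)], assumption, intro sum_mono mult_left_mono z(1))
    fix j assume j: "j \<in> {2..M-1}"
    have "qu j * f (j+1) + qd j * f (j-1) \<le> qu j * (1 - \<eta> ^ (M - (j+1))) + qd j * 1"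
      using f qu_pos[OF j] qd_pos[OF j] by (intro add_mono mult_left_mono) auto
    also have "\<dots> = 1 - qu j * \<eta> ^ (M - (j+1))"
      using qu_qd[OF j] by (simp add: algebra_simps)
    also have "\<dots> \<le> 1 - \<eta> ^ (M - j) * (2 + 2 * kt j)"
      using ratio_power[OF j] by simp
    finally have "qu j * f (j+1) + qd j * f (j-1) \<le> 1 - 2 * \<eta> ^ (M - j) - 2 * (kt j * \<eta> ^ (M - j))"
      by (simp add: algebra_simps)
    moreover have "0 \<le> kt j * \<eta> ^ (M - j)" "kt j * \<eta> ^ (M - j) \<le> kt j"
      using kt_nonneg[of j] \<eta> by (auto intro!: mult_left_le power_le_one)
    moreover have "(1 + kt j) * f j = 1 - \<eta> ^ (M - j) + kt j - kt j * \<eta> ^ (M - j)"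
      using j by (simp add: f_def algebra_simps)
    ultimately show "\<eta> ^ M \<le> (1 + kt j) * f j - qu j * f (j+1) - qd j * f (j-1)"
      using ratio_power_ge[of j] kt_nonneg[of j] by linarith
  qed
  then have "s * (\<Sum>j=2..M-1. z j * \<eta> ^ M) \<le> s * (\<Sum>j=1..M. f j * gen z j)"
    using s by (intro mult_left_mono) auto
  with 1 2 show ?thesis by (simp add: sum_distrib_left sum_distrib_right mult_ac)
qed

end

section \<open>Stationary points of the matching problem\<close>

context killed_chain
begin

definition hat :: "real \<Rightarrow> nat \<Rightarrow> real" where
  "hat m j = max 0 (1 - \<bar>m - real j\<bar>)"

lemma hat_support:
  assumes "1 \<le> m" "m \<le> real M"
  shows "\<exists>l\<in>{2..M}. (\<forall>j. j \<noteq> l - 1 \<longrightarrow> j \<noteq> l \<longrightarrow> hat m j = 0) \<and>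
    hat m (l-1) = real l - m \<and> hat m l = m - (real l - 1) \<and> (1 < m \<longrightarrow> 0 < hat m l)"
proof -
  define l where "l = (if m > 1 then nat \<lceil>m\<rceil> else 2)"
  have l: "l \<in> {2..M}" "real l - 1 \<le> m" "m \<le> real l" "1 < m \<longrightarrow> real l - 1 < m"
    using assms M unfolding l_def by (auto split: if_splits; linarith)+
  have l1: "real (l-1) = real l - 1" using l by auto
  have "hat m j = 0" if j: "j \<noteq> l - 1" "j \<noteq> l" for j
  proof -
    consider "j + 1 \<le> l - 1" | "l + 1 \<le> j" using j by linarith
    then have "real j + 1 \<le> m \<or> m + 1 \<le> real j"
    proof cases
      case 1
      then have "real j + 1 \<le> real (l-1)" by linarith
      then show ?thesis using l1 l by linarith
    next
      case 2
      then have "real l + 1 \<le> real j" by linarith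
      then show ?thesis using l by linarith
    qed
    then show ?thesis by (auto simp: hat_def)
  qed
  moreover have "hat m (l-1) = real l - m" "hat m l = m - (real l - 1)" "1 < m \<longrightarrow> 0 < hat m l"
    using l l1 by (auto simp: hat_def)
  ultimately show ?thesis using l(1) by blast
qed

lemma hat_nonneg: "0 \<le> hat m j" by (simp add: hat_def)

lemma sum_two_points:
  fixes v :: "nat \<Rightarrow> real"
  assumes "l \<in> {2..M}" "\<And>j. j \<noteq> l - 1 \<Longrightarrow> j \<noteq> l \<Longrightarrow> v j = 0"
  shows "(\<Sum>j=1..M. v j) = v (l-1) + v l"
proof -
  have "(\<Sum>j=1..M. v j) = (\<Sum>j\<in>{l-1,l}. v j)"
    using assms by (intro sum.mono_neutral_right) auto
  then show ?thesis using assms by (auto simp: numeral_2_eq_2)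
qed

lemma sum_hat:
  assumes "1 \<le> m" "m \<le> real M"
  shows "(\<Sum>j=1..M. hat m j) = 1"
proof -
  obtain l where l: "l \<in> {2..M}" "\<forall>j. j \<noteq> l - 1 \<longrightarrow> j \<noteq> l \<longrightarrow> hat m j = 0"
    and h: "hat m (l-1) = real l - m" "hat m l = m - (real l - 1)"
    using hat_support[OF assms] by blast
  show ?thesis using sum_two_points[OF l(1), of "hat m"] l(2) h by simp
qed

text \<open>$\tau D^{-1}$ in terms of $\tau = 1/\lambda$; if \<open>kt j = 0\<close> this is $\tau$, also at $\tau = 0$ because
  \<open>0 / 0 = 0\<close>.\<close>

definition damp :: "nat \<Rightarrow> real \<Rightarrow> real" where
  "damp j u = u * u / (u + s * kt j)"

lemma damp_bounds:
  assumes "0 \<le> u"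
  shows "0 \<le> damp j u" "damp j u \<le> u" "u - s * kt j \<le> damp j u"
proof -
  have k: "0 \<le> s * kt j" using s kt_nonneg by simp
  show "0 \<le> damp j u" using assms k by (simp add: damp_def)
  show "damp j u \<le> u"
  proof (cases "u = 0")
    case False
    then have "0 < u + s * kt j" using assms k by simp
    moreover have "u * u \<le> u * (u + s * kt j)"
      using assms k by (intro mult_left_mono) auto
    ultimately show ?thesis by (simp add: damp_def pos_divide_le_eq)
  qed (simp add: damp_def)
  show "u - s * kt j \<le> damp j u"
  proof (cases "u = 0")
    case False
    then have "0 < u + s * kt j" using assms k by simp
    moreover have "(u - s * kt j) * (u + s * kt j) = u * u - (s * kt j) * (s * kt j)"
      by (simp add: algebra_simps)
    then have "(u - s * kt j) * (u + s * kt j) \<le> u * u"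
      using zero_le_square[of "s * kt j"] by linarith
    ultimately show ?thesis by (simp add: damp_def pos_le_divide_eq)
  qed (use k in \<open>simp add: damp_def\<close>)
qed

lemma continuous_on_damp:
  assumes "continuous_on D f" "\<And>x. x \<in> D \<Longrightarrow> 0 \<le> f x"
  shows "continuous_on D (\<lambda>x. damp j (f x))"
proof (cases "kt j = 0")
  case False
  then have "0 < s * kt j" using s kt_nonneg[of j] by (simp add: less_eq_real_def)
  then have "f x + s * kt j \<noteq> 0" if "x \<in> D" for x using assms(2)[OF that] by linarith
  then show ?thesis unfolding damp_def by (intro continuous_intros assms(1)) auto
qed (use assms in \<open>simp add: damp_def\<close>)

text \<open>A point \<open>x\<close> of the box has the coordinates \<open>x (0, 0)\<close> (the position $m$), \<open>x (0, j)\<close> (the holding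
  time $\tau_j$) and \<open>x (n, j)\<close> (the occupation time $z_{n,j}$ of stage \<open>n \<ge> 1\<close>).\<close>

definition occ :: "(nat \<times> nat \<Rightarrow> real) \<Rightarrow> nat \<Rightarrow> nat \<Rightarrow> real" where
  "occ x n j = (if j \<in> {2..M-1} then x (n, j) else 0)"

primrec law :: "(nat \<times> nat \<Rightarrow> real) \<Rightarrow> nat \<Rightarrow> nat \<Rightarrow> real" where
  "law x 0 = hat (x (0, 0))"
| "law x (Suc n) = (\<lambda>j. if j \<in> {2..M-1}
     then (if n = 0 then damp j (x (0, j)) else x (0, j)) * x (Suc n, j)
     else law x n j - s * gen (occ x (Suc n)) j)"

lemma continuous_on_apply: "continuous_on D (\<lambda>x :: 'a \<Rightarrow> real. x i)"
  by (rule continuous_on_subset[OF continuous_on_product_coordinates]) auto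

lemma continuous_on_gen_occ: "continuous_on D (\<lambda>x. gen (occ x n) j)"
proof -
  have "continuous_on D (\<lambda>x. occ x n i)" for i
    unfolding occ_def by (cases "i \<in> {2..M-1}") (auto intro: continuous_on_apply)
  then show ?thesis unfolding gen_def by (intro continuous_intros)
qed

lemma continuous_on_law:
  assumes "\<And>x j. x \<in> D \<Longrightarrow> j \<in> {2..M-1} \<Longrightarrow> 0 \<le> x (0, j)"
  shows "continuous_on D (\<lambda>x. law x n j)"
proof (induction n arbitrary: j)
  case 0
  show ?case unfolding law.simps hat_def
    by (intro continuous_on_max continuous_intros continuous_on_apply)
next
  case (Suc n)
  show ?case
  proof (cases "j \<in> {2..M-1}")
    case True
    have "continuous_on D (\<lambda>x. if n = 0 then damp j (x (0, j)) else x (0, j))"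
      using True assms by (cases "n = 0") (auto intro!: continuous_on_damp continuous_on_apply)
    with True show ?thesis by (auto intro!: continuous_on_mult continuous_on_apply)
  next
    case False
    then have "law x (Suc n) j = law x n j - s * gen (occ x (Suc n)) j" for x
      unfolding law.simps by (simp only: if_False)
    then show ?thesis
      by (simp only:) (intro continuous_intros Suc.IH continuous_on_gen_occ)
  qed
qed

lemma gen_le:
  assumes z: "\<And>j. 0 \<le> z j" "\<And>j. j \<notin> {2..M-1} \<Longrightarrow> z j = 0"
  shows "gen z j \<le> (1 + kt j) * z j"
proof -
  have "0 \<le> qu (j-1) * z (j-1)" using z qu_pos[of "j-1"] by (cases "j-1 \<in> {2..M-1}") auto
  moreover have "0 \<le> qd (j+1) * z (j+1)" using z qd_pos[of "j+1"] by (cases "j+1 \<in> {2..M-1}") auto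
  ultimately show ?thesis unfolding gen_def by linarith
qed

end

context killed_chain_ratio
begin

lemma stationary_point:
  fixes r :: nat and T :: real and p :: "nat \<Rightarrow> real"
  assumes T: "0 \<le> T"
  obtains x where
    "1 \<le> x (0, 0)" "x (0, 0) \<le> real M"
    "\<And>j. j \<in> {2..M-1} \<Longrightarrow> 0 \<le> x (0, j) \<and> x (0, j) \<le> T"
    "\<And>n. n < r \<Longrightarrow> step (law x n) (occ x (Suc n)) (law x (Suc n))"
    "\<And>n j. n < r \<Longrightarrow> j \<in> {2..M-1} \<Longrightarrow> law x n j - s * gen (occ x (Suc n)) j = x (0, j) * occ x (Suc n) j"
    "\<And>j. j \<in> {2..M-1} \<Longrightarrow> p j * (\<Sum>i=1..M. law x r i) < law x r j \<Longrightarrow> x (0, j) = 0"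
    "\<And>j. j \<in> {2..M-1} \<Longrightarrow> law x r j < p j * (\<Sum>i=1..M. law x r i) \<Longrightarrow> x (0, j) = T"
    "(\<Sum>j=1..M. kap j * (p j * (\<Sum>i=1..M. law x r i) - law x r j)) < 0 \<Longrightarrow> x (0, 0) = 1"
    "(\<Sum>j=1..M. kap j * (p j * (\<Sum>i=1..M. law x r i) - law x r j)) > 0 \<Longrightarrow> x (0, 0) = real M"
proof -
  define B where "B = 1 / (s * \<eta> ^ M) + 1"
  have sE: "0 < s * \<eta> ^ M" using s \<eta> by simp
  then have B: "0 < B" unfolding B_def by (intro add_pos_pos divide_pos_pos) auto
  define I :: "(nat \<times> nat) set" where "I = insert (0, 0) ({0..r} \<times> {2..M-1})"
  define lo :: "nat \<times> nat \<Rightarrow> real" where "lo = (\<lambda>(n, j). if j = 0 then 1 else 0)"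
  define hi :: "nat \<times> nat \<Rightarrow> real" where
    "hi = (\<lambda>(n, j). if j = 0 then real M else if n = 0 then T else B)"
  define F :: "(nat \<times> nat \<Rightarrow> real) \<Rightarrow> nat \<times> nat \<Rightarrow> real" where
    "F x = (\<lambda>(n, j). if j = 0 then (\<Sum>j=1..M. kap j * (p j * (\<Sum>i=1..M. law x r i) - law x r j))
       else if n = 0 then p j * (\<Sum>i=1..M. law x r i) - law x r j
       else law x (n-1) j - s * gen (occ x n) j - x (0, j) * x (n, j))" for x
  define D where "D = {x. \<forall>i\<in>I. lo i \<le> x i \<and> x i \<le> hi i}"
  have I0: "(0, 0) \<in> I" by (simp add: I_def)
  have I1: "(n, j) \<in> I" if "n \<le> r" "j \<in> {2..M-1}" for n j using that by (simp add: I_def)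
  have D0: "0 \<le> x (0, j)" if "x \<in> D" "j \<in> {2..M-1}" for x j
  proof -
    have "lo (0, j) \<le> x (0, j)" using that I1[of 0 j] by (simp add: D_def)
    then show ?thesis using that by (simp add: lo_def)
  qed
  have claw: "continuous_on D (\<lambda>x. law x n j)" for n j
    by (rule continuous_on_law) (rule D0)
  have cont: "continuous_on D (\<lambda>x. F x i)" for i
  proof -
    obtain n j where i: "i = (n, j)" by (cases i)
    consider "j = 0" | "j \<noteq> 0" "n = 0" | "j \<noteq> 0" "n \<noteq> 0" by blast
    then show ?thesis
      unfolding i F_def
      by cases (simp_all, (intro continuous_intros claw continuous_on_apply continuous_on_gen_occ)+)
  qed
  have fin: "finite I" by (simp add: I_def)
  have lohi: "\<forall>i\<in>I. lo i \<le> hi i"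
    using M T B by (auto simp: I_def lo_def hi_def)
  obtain x where "\<forall>i\<in>I. lo i \<le> x i \<and> x i \<le> hi i \<and>
      (0 < F x i \<longrightarrow> x i = hi i) \<and> (F x i < 0 \<longrightarrow> x i = lo i)"
    using box_variational_inequality[OF fin lohi, of F] cont unfolding D_def by blast
  then have x: "\<And>i. i \<in> I \<Longrightarrow> lo i \<le> x i \<and> x i \<le> hi i"
    and Fpos: "\<And>i. i \<in> I \<Longrightarrow> 0 < F x i \<Longrightarrow> x i = hi i"
    and Fneg: "\<And>i. i \<in> I \<Longrightarrow> F x i < 0 \<Longrightarrow> x i = lo i"
    by simp_all
  have m: "1 \<le> x (0, 0)" "x (0, 0) \<le> real M" using x[OF I0] by (auto simp: lo_def hi_def)
  have tau: "0 \<le> x (0, j) \<and> x (0, j) \<le> T" if "j \<in> {2..M-1}" for j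
    using x[OF I1[of 0 j]] that by (auto simp: lo_def hi_def)
  have one: "step (law x n) (occ x (Suc n)) (law x (Suc n)) \<and>
      (\<forall>j\<in>{2..M-1}. law x n j - s * gen (occ x (Suc n)) j = x (0, j) * occ x (Suc n) j)"
    if n: "n < r" and y0: "\<And>j. j \<in> {1..M} \<Longrightarrow> 0 \<le> law x n j" and y1: "(\<Sum>j=1..M. law x n j) \<le> 1" for n
  proof -
    define y where "y = law x n"
    define z where "z = occ x (Suc n)"
    have z0: "z j = 0" if "j \<notin> {2..M-1}" for j using that by (auto simp: z_def occ_def)
    have zI: "z j = x (Suc n, j)" if "j \<in> {2..M-1}" for j using that by (simp add: z_def occ_def)
    have z: "0 \<le> z j" for j
    proof (cases "j \<in> {2..M-1}")
      case True
      then show ?thesis using x[OF I1[of "Suc n" j]] n by (auto simp: lo_def zI)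
    qed (simp add: z0)
    have FI: "F x (Suc n, j) = y j - s * gen z j - x (0, j) * z j" if "j \<in> {2..M-1}" for j
      using that zI[OF that] by (simp add: F_def y_def z_def)
    have G0: "y j \<le> y j - s * gen z j" if "z j = 0" for j
      using gen_le[of z j, OF z z0] that s by (simp add: mult_le_0_iff)
    have Fge: "x (0, j) * z j \<le> y j - s * gen z j" if j: "j \<in> {2..M-1}" for j
    proof (rule ccontr)
      assume "\<not> ?thesis"
      then have neg: "F x (Suc n, j) < 0" by (simp add: FI[OF j])
      from Fneg[OF I1 this] n j have "z j = 0" by (auto simp: lo_def zI)
      moreover have "0 \<le> y j" unfolding y_def using j by (intro y0) auto
      ultimately have "0 \<le> F x (Suc n, j)"
        using G0[of j] unfolding FI[OF j] by simp
      with neg show False by simp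
    qed
    have G: "0 \<le> y j - s * gen z j" if "j \<in> {1..M}" for j
    proof (cases "j \<in> {2..M-1}")
      case True
      have "0 \<le> x (0, j) * z j" using tau[OF True] z by simp
      then show ?thesis using Fge[OF True] by linarith
    next
      case False
      then show ?thesis using G0[OF z0[OF False]] y0[OF that] by (simp add: y_def)
    qed
    have "s * \<eta> ^ M * (\<Sum>j=2..M-1. z j) \<le> (\<Sum>j=2..M-1. y j)"
      using z z0 y0 G by (intro occupation_bound) (auto simp: y_def)
    also have "\<dots> \<le> (\<Sum>j=1..M. y j)"
      using y0 by (intro sum_mono2) (auto simp: y_def)
    also have "\<dots> \<le> 1" using y1 by (simp add: y_def)
    finally have "(\<Sum>j=2..M-1. z j) \<le> 1 / (s * \<eta> ^ M)"
      using sE by (simp add: pos_le_divide_eq mult.commute)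
    then have "(\<Sum>j=2..M-1. z j) < B" by (simp add: B_def)
    moreover have "z j \<le> (\<Sum>j=2..M-1. z j)" if "j \<in> {2..M-1}" for j
      using that z by (intro member_le_sum) auto
    ultimately have zB: "z j < B" if "j \<in> {2..M-1}" for j using that by force
    have eq: "y j - s * gen z j = x (0, j) * z j" if j: "j \<in> {2..M-1}" for j
    proof (rule ccontr)
      assume "\<not> ?thesis"
      then have "0 < F x (Suc n, j)" using Fge[OF j] by (simp add: FI[OF j])
      from Fpos[OF I1 this] n j have "z j = B" by (auto simp: hi_def zI)
      with zB[OF j] show False by simp
    qed
    have "step y z (law x (Suc n))"
      unfolding step_def
    proof (intro conjI allI impI ballI)
      fix j assume j: "j \<in> {1..M}"
      define c where "c = (if n = 0 then damp j (x (0, j)) else x (0, j))"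
      have "0 \<le> law x (Suc n) j \<and> law x (Suc n) j \<le> y j - s * gen z j \<and>
          y j - s * gen z j - s * kt j * z j \<le> law x (Suc n) j"
      proof (cases "j \<in> {2..M-1}")
        case True
        have c: "0 \<le> c" "c \<le> x (0, j)" "x (0, j) - s * kt j \<le> c"
          using damp_bounds[of "x (0, j)" j] tau[OF True] s kt_nonneg[of j] by (auto simp: c_def)
        have l: "law x (Suc n) j = c * z j"
          unfolding law.simps zI[OF True] c_def using True by simp
        have "(x (0, j) - s * kt j) * z j \<le> c * z j" using c z by (intro mult_right_mono) auto
        then have "x (0, j) * z j - s * kt j * z j \<le> c * z j" by (simp add: left_diff_distrib)
        moreover have "c * z j \<le> x (0, j) * z j" "0 \<le> c * z j" using c z by (auto intro: mult_right_mono)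
        ultimately show ?thesis unfolding l eq[OF True] by simp
      next
        case False
        then have l: "law x (Suc n) j = y j - s * gen z j"
          unfolding law.simps y_def z_def by (simp only: if_False)
        show ?thesis using G[OF j] z0[OF False] unfolding l by simp
      qed
      then show "0 \<le> law x (Suc n) j" "law x (Suc n) j \<le> y j - s * gen z j"
        "y j - s * gen z j - s * kt j * z j \<le> law x (Suc n) j" by blast+
    qed (use z z0 in auto)
    then show ?thesis using eq by (simp add: y_def z_def)
  qed
  have inv: "(\<forall>j\<in>{1..M}. 0 \<le> law x n j) \<and> (\<Sum>j=1..M. law x n j) \<le> 1" if "n \<le> r" for n
    using that
  proof (induction n)
    case 0
    show ?case using sum_hat[OF m] by (simp add: hat_nonneg)
  next
    case (Suc n)
    then have st: "step (law x n) (occ x (Suc n)) (law x (Suc n))" using one[of n] by simp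
    have "(\<Sum>j=1..M. law x (Suc n) j) \<le> 1"
      using step_mass[OF st] Suc by simp
    moreover have "\<forall>j\<in>{1..M}. 0 \<le> law x (Suc n) j" using st by (simp add: step_def del: law.simps)
    ultimately show ?case by blast
  qed
  have all: "step (law x n) (occ x (Suc n)) (law x (Suc n)) \<and>
      (\<forall>j\<in>{2..M-1}. law x n j - s * gen (occ x (Suc n)) j = x (0, j) * occ x (Suc n) j)"
    if "n < r" for n
    using one[OF that] inv[of n] that by simp
  show thesis
  proof (rule that[of x])
    show "x (0, j) = 0" if "j \<in> {2..M-1}" "p j * (\<Sum>i=1..M. law x r i) < law x r j" for j
      using Fneg[OF I1[of 0 j]] that by (auto simp: F_def lo_def)
    show "x (0, j) = T" if "j \<in> {2..M-1}" "law x r j < p j * (\<Sum>i=1..M. law x r i)" for j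
      using Fpos[OF I1[of 0 j]] that by (auto simp: F_def hi_def)
    show "x (0, 0) = 1"
      if "(\<Sum>j=1..M. kap j * (p j * (\<Sum>i=1..M. law x r i) - law x r j)) < 0"
      using Fneg[OF I0] that by (simp add: F_def lo_def)
    show "x (0, 0) = real M"
      if "(\<Sum>j=1..M. kap j * (p j * (\<Sum>i=1..M. law x r i) - law x r j)) > 0"
      using Fpos[OF I0] that by (simp add: F_def hi_def)
    show "step (law x n) (occ x (Suc n)) (law x (Suc n))" if "n < r" for n
      using all[OF that] by blast
    show "law x n j - s * gen (occ x (Suc n)) j = x (0, j) * occ x (Suc n) j"
      if "n < r" "j \<in> {2..M-1}" for n j
      using all[OF that(1)] that(2) by blast
    show "1 \<le> x (0, 0)" "x (0, 0) \<le> real M" by (rule m)+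
    show "0 \<le> x (0, j) \<and> x (0, j) \<le> T" if "j \<in> {2..M-1}" for j
      by (rule tau[OF that])
  qed
qed

end

context killed_chain
begin

lemma sum_ends:
  fixes f :: "nat \<Rightarrow> real"
  shows "(\<Sum>j=1..M. f j) = f 1 + (\<Sum>j=2..M-1. f j) + f M"
proof -
  have "{1..M} = insert 1 (insert M {2..M-1})" using M by auto
  then show ?thesis using M by simp
qed

lemma balanced_ends:
  assumes "(\<Sum>j=1..M. a j) = 0" "(\<Sum>j=1..M. kap j * a j) = 0"
    and "\<And>j. j \<in> {2..M-1} \<Longrightarrow> 0 \<le> a j"
  shows "a 1 \<le> 0" "a M \<le> 0"
proof -
  have d: "0 < kap M - kap 1" using kap_strict[of 1 M] M by simp
  have z: "(\<Sum>j=1..M. (kap j - c) * a j) = 0" for c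
    using assms(1,2) by (simp add: left_diff_distrib sum_subtractf sum_distrib_left[symmetric])
  have "0 \<le> (\<Sum>j=2..M-1. (kap j - kap 1) * a j)"
    using assms(3) kap_mono[of 1] by (intro sum_nonneg mult_nonneg_nonneg) auto
  then have "(kap M - kap 1) * a M \<le> 0" using z[of "kap 1", unfolded sum_ends] by simp
  then show "a M \<le> 0" using d by (simp add: mult_le_0_iff)
  have "(\<Sum>j=2..M-1. (kap j - kap M) * a j) \<le> 0"
    using assms(3) kap_mono[of _ M] by (intro sum_nonpos mult_nonpos_nonneg) auto
  then have "0 \<le> (kap 1 - kap M) * a 1" using z[of "kap M", unfolded sum_ends] by simp
  then show "a 1 \<le> 0" using d by (simp add: zero_le_mult_iff)
qed

lemma mean_strict:
  assumes p: "\<And>j. j \<in> {1..M} \<Longrightarrow> 0 < p j" "(\<Sum>j=1..M. p j) = 1"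
  shows "kap 1 < (\<Sum>j=1..M. kap j * p j)" "(\<Sum>j=1..M. kap j * p j) < kap M"
proof -
  have e: "(\<Sum>j=1..M. (kap j - c) * p j) = (\<Sum>j=1..M. kap j * p j) - c" for c
    using p(2) by (simp add: left_diff_distrib sum_subtractf sum_distrib_left[symmetric])
  have "0 < (\<Sum>j=1..M. (kap j - kap 1) * p j)"
    using M p kap_strict[of 1 M] by (intro sum_pos2[of _ M] mult_pos_pos mult_nonneg_nonneg)
      (auto intro: kap_mono less_imp_le)
  then show "kap 1 < (\<Sum>j=1..M. kap j * p j)" using e[of "kap 1"] by simp
  have "0 < (\<Sum>j=1..M. (kap M - kap j) * p j)"
    using M p kap_strict[of 1 M] by (intro sum_pos2[of _ 1] mult_pos_pos mult_nonneg_nonneg)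
      (auto intro: kap_mono less_imp_le)
  also have "\<dots> = - (\<Sum>j=1..M. (kap j - kap M) * p j)"
    by (simp add: sum_negf[symmetric] algebra_simps)
  finally show "(\<Sum>j=1..M. kap j * p j) < kap M" using e[of "kap M"] by simp
qed

lemma gen_zero:
  assumes "\<And>j. z j = 0"
  shows "gen z j = 0"
  by (simp add: gen_def assms)

lemma zero_propagates:
  assumes z: "\<And>j. 0 \<le> z j" "\<And>j. j \<notin> {2..M-1} \<Longrightarrow> z j = 0"
    and gen: "\<And>j. j \<in> {2..M-1} \<Longrightarrow> z j = 0 \<Longrightarrow> 0 \<le> gen z j"
    and j0: "j0 \<in> {2..M-1}" "z j0 = 0"
  shows "z j = 0"
proof -
  have nb: "z (j+1) = 0 \<and> z (j-1) = 0" if j: "j \<in> {2..M-1}" "z j = 0" for j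
  proof -
    have q: "0 \<le> qu (j-1) * z (j-1)" "0 \<le> qd (j+1) * z (j+1)"
      using z qu_pos[of "j-1"] qd_pos[of "j+1"]
      by (cases "j-1 \<in> {2..M-1}", force, force, cases "j+1 \<in> {2..M-1}", force, force)
    have "0 \<le> - (qu (j-1) * z (j-1)) - qd (j+1) * z (j+1)"
      using gen[OF j] j(2) by (simp add: gen_def)
    with q have "qu (j-1) * z (j-1) = 0" "qd (j+1) * z (j+1) = 0" by linarith+
    then show ?thesis
      using z(2)[of "j-1"] z(2)[of "j+1"] qu_pos[of "j-1"] qd_pos[of "j+1"] by force
  qed
  have up: "z (j0 + d) = 0" for d
  proof (induction d)
    case (Suc d)
    show ?case
    proof (cases "j0 + d \<in> {2..M-1}")
      case False
      then show ?thesis using j0 by (intro z(2)) auto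
    qed (use nb[of "j0 + d"] Suc in simp)
  qed (use j0 in simp)
  have down: "z (j0 - d) = 0" for d
  proof (induction d)
    case (Suc d)
    show ?case
    proof (cases "j0 - d \<in> {2..M-1}")
      case True
      then show ?thesis using nb[OF True Suc] by (simp add: diff_diff_left)
    next
      case False
      then show ?thesis using j0 by (intro z(2)) auto
    qed
  qed (use j0 in simp)
  show ?thesis using up[of "j - j0"] down[of "j0 - j"] by (cases "j0 \<le> j") auto
qed

end

context killed_chain_ratio
begin

lemma step_frozen:
  assumes st: "step y z y'" and y: "\<And>j. j \<in> {1..M} \<Longrightarrow> 0 \<le> y j" "\<And>j. j \<in> {2..M-1} \<Longrightarrow> y j = 0"
    and j: "j \<in> {1..M}"
  shows "y' j = y j"
proof -
  have z: "0 \<le> z j" "j \<notin> {2..M-1} \<Longrightarrow> z j = 0" for j using st by (auto simp: step_def)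
  have "0 \<le> y j - s * gen z j" if "j \<in> {1..M}" for j
    using st that unfolding step_def by (meson order_trans)
  then have "s * \<eta> ^ M * (\<Sum>j=2..M-1. z j) \<le> (\<Sum>j=2..M-1. y j)"
    by (intro occupation_bound z y(1))
  also have "(\<Sum>j=2..M-1. y j) = 0" using y(2) by simp
  finally have "s * \<eta> ^ M * (\<Sum>j=2..M-1. z j) \<le> s * \<eta> ^ M * 0" by simp
  moreover have "0 < s * \<eta> ^ M" using s \<eta> by simp
  ultimately have "(\<Sum>j=2..M-1. z j) \<le> 0" by (simp only: mult_le_cancel_left_pos)
  then have "(\<Sum>j=2..M-1. z j) = 0" using sum_nonneg[of "{2..M-1}" z] z(1) by (simp add: order_antisym)
  then have "\<forall>j\<in>{2..M-1}. z j = 0" using z(1) by (subst (asm) sum_nonneg_eq_0_iff) auto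
  then have z0: "z j = 0" for j using z(2) by blast
  have "y' j \<le> y j - s * gen z j" "y j - s * gen z j - s * kt j * z j \<le> y' j"
    using st j by (auto simp: step_def)
  then show ?thesis by (simp add: gen_zero[OF z0] z0)
qed

lemma matching_occupations:
  fixes r :: nat and p :: "nat \<Rightarrow> real"
  assumes r: "r \<ge> 1" and p: "\<And>j. j \<in> {1..M} \<Longrightarrow> 0 < p j" "(\<Sum>j=1..M. p j) = 1"
  obtains x S where "0 < S" "1 < x (0, 0)" "x (0, 0) \<le> real M"
    "\<And>j. j \<in> {2..M-1} \<Longrightarrow> 0 < x (0, j)"
    "\<And>n. n < r \<Longrightarrow> step (law x n) (occ x (Suc n)) (law x (Suc n))"
    "\<And>n j. n < r \<Longrightarrow> j \<in> {2..M-1} \<Longrightarrow> law x n j - s * gen (occ x (Suc n)) j = x (0, j) * occ x (Suc n) j"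
    "\<And>j. j \<in> {1..M} \<Longrightarrow> law x r j = S * p j"
proof -
  define E where "E = \<eta> ^ M"
  have E: "0 < E" using \<eta> by (simp add: E_def)
  define pm where "pm = min (p 1) (p M)"
  have pm: "0 < pm" "pm \<le> p 1" "pm \<le> p M" using p(1)[of 1] p(1)[of M] M by (auto simp: pm_def)
  define T where "T = real r * s / (E * pm) + 1"
  have "0 \<le> real r * s / (E * pm)" using E pm s by simp
  then have T: "0 < T" "real r * s / (E * pm) < T" by (auto simp: T_def)
  obtain x where m: "1 \<le> x (0, 0)" "x (0, 0) \<le> real M"
    and tau: "\<And>j. j \<in> {2..M-1} \<Longrightarrow> 0 \<le> x (0, j) \<and> x (0, j) \<le> T"
    and st: "\<And>n. n < r \<Longrightarrow> step (law x n) (occ x (Suc n)) (law x (Suc n))"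
    and eq: "\<And>n j. n < r \<Longrightarrow> j \<in> {2..M-1} \<Longrightarrow> law x n j - s * gen (occ x (Suc n)) j = x (0, j) * occ x (Suc n) j"
    and tau0: "\<And>j. j \<in> {2..M-1} \<Longrightarrow> p j * (\<Sum>i=1..M. law x r i) < law x r j \<Longrightarrow> x (0, j) = 0"
    and tauT: "\<And>j. j \<in> {2..M-1} \<Longrightarrow> law x r j < p j * (\<Sum>i=1..M. law x r i) \<Longrightarrow> x (0, j) = T"
    and m0: "(\<Sum>j=1..M. kap j * (p j * (\<Sum>i=1..M. law x r i) - law x r j)) < 0 \<Longrightarrow> x (0, 0) = 1"
    and mM: "(\<Sum>j=1..M. kap j * (p j * (\<Sum>i=1..M. law x r i) - law x r j)) > 0 \<Longrightarrow> x (0, 0) = real M"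
  proof (rule stationary_point[of T r p, OF less_imp_le[OF T(1)]], goal_cases)
    case (1 x)
    from 1(2-) show thesis by (rule 1(1))
  qed
  define S where "S = (\<Sum>i=1..M. law x r i)"
  define a where "a j = p j * S - law x r j" for j
  have law0: "law x 0 j = hat (x (0, 0)) j" for j by simp
  have nonneg: "0 \<le> law x n j" if "n \<le> r" "j \<in> {1..M}" for n j
  proof (cases n)
    case (Suc n')
    then have "step (law x n') (occ x (Suc n')) (law x n)" using st[of n'] that by simp
    then show ?thesis using that(2) unfolding step_def by blast
  qed (simp add: hat_nonneg)
  have surv: "E \<le> (\<Sum>j=1..M. \<eta> ^ (M - j) * law x n j)" if "n \<le> r" for n
    using that
  proof (induction n)
    case 0
    have "E * (\<Sum>j=1..M. law x 0 j) \<le> (\<Sum>j=1..M. \<eta> ^ (M - j) * law x 0 j)"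
      unfolding sum_distrib_left E_def
      by (intro sum_mono mult_right_mono ratio_power_ge nonneg) auto
    then show ?case using sum_hat[OF m] by (simp only: law0 mult_1_right)
  next
    case (Suc n)
    then show ?case using step_survival[OF st[of n]] by (simp del: law.simps)
  qed
  have "(\<Sum>j=1..M. \<eta> ^ (M - j) * law x r j) \<le> (\<Sum>j=1..M. 1 * law x r j)"
    using \<eta> by (intro sum_mono mult_right_mono power_le_one nonneg) auto
  then have SE: "E \<le> S" using surv[of r] by (simp add: S_def)
  then have S: "0 < S" using E by simp
  have frozen: "law x n j = law x n0 j"
    if "n0 \<le> n" "n \<le> r" "j \<in> {1..M}" and z: "\<And>j. j \<in> {2..M-1} \<Longrightarrow> law x n0 j = 0" for n n0 j
    using that(1-3)
  proof (induction n arbitrary: j rule: dec_induct)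
    case (step n)
    have n: "n < r" using step by simp
    have "law x (Suc n) j = law x n j"
    proof (rule step_frozen[OF st[OF n]])
      show "0 \<le> law x n i" if "i \<in> {1..M}" for i using n that by (intro nonneg) auto
      show "law x n i = 0" if "i \<in> {2..M-1}" for i
        using step.IH[of i] z[OF that] that n by auto
      show "j \<in> {1..M}" by (rule step.prems)
    qed
    then show ?case using step.IH[of j] step.prems n by simp
  qed simp
  have sumF: "(\<Sum>j=1..M. kap j * a j) = (\<Sum>j=1..M. kap j * p j) - kap c"
    if c: "x (0, 0) = real c" "c \<in> {1, M}" for c
  proof -
    have h: "law x 0 j = (if j = c then 1 else 0)" for j
    proof -
      have "1 \<le> \<bar>real c - real j\<bar>" if "j \<noteq> c" using that by linarith
      then show ?thesis unfolding law0 c(1) hat_def by auto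
    qed
    have lr: "law x r j = (if j = c then 1 else 0)" if "j \<in> {1..M}" for j
    proof -
      have "law x r j = law x 0 j"
        using that c(2) by (intro frozen) (auto simp: h simp del: law.simps)
      then show ?thesis by (simp add: h del: law.simps)
    qed
    have cM: "c \<in> {1..M}" using c(2) M by auto
    have "S = (\<Sum>j=1..M. if j = c then 1 else 0)"
      unfolding S_def by (intro sum.cong refl lr)
    then have "S = 1" using cM by simp
    have "(\<Sum>j=1..M. kap j * a j) = (\<Sum>j=1..M. kap j * p j - (if j = c then kap j else 0))"
      by (intro sum.cong refl) (simp add: a_def lr \<open>S = 1\<close> right_diff_distrib)
    also have "\<dots> = (\<Sum>j=1..M. kap j * p j) - kap c"
      using cM by (simp add: sum_subtractf)
    finally show ?thesis .
  qed
  note ms = mean_strict[OF p]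
  have m1: "x (0, 0) \<noteq> 1"
  proof
    assume 1: "x (0, 0) = 1"
    then have "0 < (\<Sum>j=1..M. kap j * a j)" using sumF[of 1] ms(1) by simp
    then have "x (0, 0) = real M" using mM by (simp add: a_def S_def)
    then show False using 1 M by simp
  qed
  have mM': "x (0, 0) \<noteq> real M"
  proof
    assume 1: "x (0, 0) = real M"
    then have "(\<Sum>j=1..M. kap j * a j) < 0" using sumF[of M] ms(2) by simp
    then have "x (0, 0) = 1" using m0 by (simp add: a_def S_def)
    then show False using m1 by simp
  qed
  have bal: "(\<Sum>j=1..M. kap j * a j) = 0"
    using m0 mM m1 mM' unfolding a_def S_def by (meson linorder_neqE_linordered_idom)
  have sum0: "(\<Sum>j=1..M. a j) = 0"
    unfolding a_def sum_subtractf using p(2) by (simp add: sum_distrib_right[symmetric] S_def)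
  obtain r' where r': "r = Suc r'" using r by (cases r) auto
  have taupos: "0 < x (0, j)" if j: "j \<in> {2..M-1}" for j
  proof (rule ccontr)
    assume "\<not> ?thesis"
    then have 0: "x (0, j) = 0" using tau[OF j] by simp
    then have "law x r j = 0" unfolding r' law.simps damp_def using j by simp
    moreover have "0 < p j * S" using S p(1)[of j] j by auto
    ultimately have "x (0, j) = T" using tauT[OF j] by (simp add: S_def)
    then show False using 0 T by simp
  qed
  have a_nonneg: "0 \<le> a j" if "j \<in> {2..M-1}" for j
    using tau0[OF that] taupos[OF that] unfolding a_def S_def by force
  note ends = balanced_ends[OF sum0 bal a_nonneg]
  obtain l where l: "l \<in> {2..M}" and hl: "\<forall>j. j \<noteq> l - 1 \<longrightarrow> j \<noteq> l \<longrightarrow> hat (x (0, 0)) j = 0"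
    using hat_support[OF m] by blast
  have mass1: "(\<Sum>j=1..M. law x n j) \<le> 1" if "n \<le> r" for n
    using that
  proof (induction n)
    case 0
    show ?case using sum_hat[OF m] by simp
  next
    case (Suc n)
    then show ?case using step_mass[OF st[of n]] by (simp del: law.simps)
  qed
  have tauneq: "x (0, j) \<noteq> T" if j: "j \<in> {2..M-1}" for j
  proof
    assume TT: "x (0, j) = T"
    have zb: "s * occ x (Suc n) j \<le> s / T" if n: "n < r" for n
    proof -
      let ?y' = "\<lambda>j. law x n j - s * gen (occ x (Suc n)) j"
      have st': "step (law x n) (occ x (Suc n)) ?y'"
        using st[OF n] s kt_nonneg unfolding step_def by fastforce
      have "?y' j \<le> (\<Sum>i=1..M. ?y' i)"
        using st' j by (intro member_le_sum) (auto simp: step_def)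
      also have "\<dots> \<le> 1" using step_mass[OF st'] mass1[of n] n by simp
      finally have "T * occ x (Suc n) j \<le> 1" using eq[OF n j] TT by simp
      then have "occ x (Suc n) j \<le> 1 / T" using T by (simp add: pos_le_divide_eq mult.commute)
      then show ?thesis using mult_left_mono[of "occ x (Suc n) j" "1 / T" s] s by simp
    qed
    have "real r * s < T * (E * pm)" using T(2) E pm by (simp add: pos_divide_less_eq)
    then have small: "real r * (s / T) < E * pm" using T(1) by (simp add: pos_divide_less_eq mult.commute)
    show False
    proof (cases "j \<le> l - 1")
      case True
      have "(\<Sum>i=1..j-1. law x n i) \<le> real n * (s / T)" if "n \<le> r" for n
        using that
      proof (induction n)
        case 0
        have "(\<Sum>i=1..j-1. law x 0 i) = 0"
          using hl True by (intro sum.neutral) auto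
        then show ?case by simp
      next
        case (Suc n)
        then have "(\<Sum>i=1..j-1. law x (Suc n) i) \<le> (\<Sum>i=1..j-1. law x n i) + s / T"
          using step_left[OF st[of n] j] zb[of n] by simp
        then show ?case using Suc by (simp add: distrib_right add_divide_distrib del: law.simps)
      qed
      then have "(\<Sum>i=1..j-1. law x r i) \<le> real r * (s / T)" by blast
      moreover have "law x r 1 \<le> (\<Sum>i=1..j-1. law x r i)"
        using j by (intro member_le_sum nonneg) auto
      moreover have "p 1 * S \<le> law x r 1" using ends by (simp add: a_def)
      moreover have "E * pm \<le> p 1 * S" using SE pm E S mult_mono[of pm "p 1" E S] by (simp add: mult.commute)
      ultimately show False using small by linarith
    next
      case False
      have "(\<Sum>i=j+1..M. law x n i) \<le> real n * (s / T)" if "n \<le> r" for n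
        using that
      proof (induction n)
        case 0
        have "(\<Sum>i=j+1..M. law x 0 i) = 0"
          using hl False l by (intro sum.neutral) auto
        then show ?case by simp
      next
        case (Suc n)
        then have "(\<Sum>i=j+1..M. law x (Suc n) i) \<le> (\<Sum>i=j+1..M. law x n i) + s / T"
          using step_right[OF st[of n] j] zb[of n] by simp
        then show ?case using Suc by (simp add: distrib_right add_divide_distrib del: law.simps)
      qed
      then have "(\<Sum>i=j+1..M. law x r i) \<le> real r * (s / T)" by blast
      moreover have "law x r M \<le> (\<Sum>i=j+1..M. law x r i)"
        using j by (intro member_le_sum nonneg) auto
      moreover have "p M * S \<le> law x r M" using ends by (simp add: a_def)
      moreover have "E * pm \<le> p M * S" using SE pm E S mult_mono[of pm "p M" E S] by (simp add: mult.commute)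
      ultimately show False using small by linarith
    qed
  qed
  have aI: "a j = 0" if "j \<in> {2..M-1}" for j
    using tauT[OF that] tauneq[OF that] a_nonneg[OF that] unfolding a_def S_def by force
  then have "(\<Sum>j=2..M-1. a j) = 0" by simp
  then have "a 1 + a M = 0" using sum0 unfolding sum_ends by simp
  with ends have "a 1 = 0" "a M = 0" by linarith+
  then have "a j = 0" if "j \<in> {1..M}" for j
    using aI[of j] that by (cases "j = 1 \<or> j = M") auto
  then have fin: "law x r j = S * p j" if "j \<in> {1..M}" for j
    using that by (simp add: a_def mult.commute)
  show thesis
  proof (rule that[of S x])
    show "1 < x (0, 0)" using m m1 by simp
  qed (fact S m taupos st eq fin)+
qed

end

section \<open>Rates matching a target law\<close>

context killed_chain
begin

lemma kap_martingale:
  assumes "j \<in> {2..M-1}"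
  shows "qu j * kap (j+1) + qd j * kap (j-1) = kap j"
proof -
  define A where "A = kap (j+1) - kap (j-1)"
  have A: "A \<noteq> 0" using kap_interior[OF assms] by (simp add: A_def)
  have "qu j * kap (j+1) + qd j * kap (j-1) =
      ((kap j - kap (j-1)) * kap (j+1) + (kap (j+1) - kap j) * kap (j-1)) / A"
    using assms by (simp add: qu qd A_def add_divide_distrib)
  also have "(kap j - kap (j-1)) * kap (j+1) + (kap (j+1) - kap j) * kap (j-1) = kap j * A"
    by (simp add: A_def algebra_simps)
  finally show ?thesis using A by simp
qed

lemma balance_test:
  assumes lam: "\<And>j. j \<notin> {2..M-1} \<Longrightarrow> lam j = 0"
    and bal: "\<And>j. j \<in> {1..M} \<Longrightarrow> w j + s * gen (\<lambda>i. lam i * w i) j = \<mu> j"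
  shows "(\<Sum>j=1..M. f j * (w j * (1 + s * lam j * kt j))) =
    (\<Sum>j=1..M. f j * \<mu> j) + s * (\<Sum>j=2..M-1. lam j * w j * (qu j * f (j+1) + qd j * f (j-1) - f j))"
proof -
  have dual: "(\<Sum>j=1..M. f j * gen (\<lambda>i. lam i * w i) j) =
      (\<Sum>j=2..M-1. lam j * w j * ((1 + kt j) * f j - qu j * f (j+1) - qd j * f (j-1)))"
    by (rule gen_duality) (simp add: lam)
  have kt: "(\<Sum>j=1..M. f j * (w j * (s * lam j * kt j))) = s * (\<Sum>j=2..M-1. lam j * w j * (kt j * f j))"
    using sum_interior[of "\<lambda>j. f j * (w j * (s * lam j * kt j))"] lam
    by (simp add: sum_distrib_left mult_ac)
  have "(\<Sum>j=1..M. f j * \<mu> j) = (\<Sum>j=1..M. f j * (w j + s * gen (\<lambda>i. lam i * w i) j))"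
    by (intro sum.cong refl) (simp only: bal)
  also have "\<dots> = (\<Sum>j=1..M. f j * w j) + s * (\<Sum>j=1..M. f j * gen (\<lambda>i. lam i * w i) j)"
    by (simp add: distrib_left sum.distrib sum_distrib_left mult_ac)
  finally have 1: "(\<Sum>j=1..M. f j * \<mu> j) = \<dots>" .
  have "(\<Sum>j=1..M. f j * (w j * (1 + s * lam j * kt j))) =
      (\<Sum>j=1..M. f j * w j) + s * (\<Sum>j=2..M-1. lam j * w j * (kt j * f j))"
    unfolding kt[symmetric] sum.distrib[symmetric] by (simp add: algebra_simps)
  also have "s * (\<Sum>j=2..M-1. lam j * w j * (kt j * f j)) =
      s * (\<Sum>j=1..M. f j * gen (\<lambda>i. lam i * w i) j) +
      s * (\<Sum>j=2..M-1. lam j * w j * (qu j * f (j+1) + qd j * f (j-1) - f j))"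
    unfolding dual distrib_left[symmetric] sum.distrib[symmetric]
    by (intro arg_cong[of _ _ "\<lambda>u. s * u"] sum.cong refl) (simp add: algebra_simps)
  finally show ?thesis using 1 by simp
qed

lemma balance_mass:
  assumes lam: "\<And>j. j \<notin> {2..M-1} \<Longrightarrow> lam j = 0"
    and bal: "\<And>j. j \<in> {1..M} \<Longrightarrow> w j + s * gen (\<lambda>i. lam i * w i) j = \<mu> j"
  shows "(\<Sum>j=1..M. w j * (1 + s * lam j * kt j)) = (\<Sum>j=1..M. \<mu> j)"
  using balance_test[of lam w \<mu> "\<lambda>_. 1", OF lam bal] qu_qd by simp

lemma G_system_of_balance:
  assumes lam: "lam \<in> rate_vectors M"
    and w: "\<And>j. j \<in> {1..M} \<Longrightarrow> 0 < w j"
    and bal: "\<And>j. j \<in> {1..M} \<Longrightarrow> w j + s * gen (\<lambda>i. lam i * w i) j = \<mu> j"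
    and l: "l \<in> {2..M}" "\<And>j. j \<noteq> l - 1 \<Longrightarrow> j \<noteq> l \<Longrightarrow> \<mu> j = 0" "0 \<le> \<mu> (l-1)" "0 < \<mu> l"
    and c: "0 < c" "\<And>j. j \<in> {1..M} \<Longrightarrow> \<pi> j = c * w j"
  shows "G_system M kap kt s \<pi> lam"
proof -
  define v where "v a = \<pi> a * (1 + s * lam a * kt a)" for a
  have lam0: "lam j = 0" if "j \<notin> {2..M-1}" for j using lam that by (simp add: rate_vectors_def)
  have test: "(\<Sum>j=1..M. f j * v j) = c * (f (l-1) * \<mu> (l-1) + f l * \<mu> l) +
      c * s * (\<Sum>j=2..M-1. lam j * w j * (qu j * f (j+1) + qd j * f (j-1) - f j))" for f
  proof -
    have "(\<Sum>j=1..M. f j * v j) = c * (\<Sum>j=1..M. f j * (w j * (1 + s * lam j * kt j)))"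
      unfolding sum_distrib_left v_def by (intro sum.cong refl) (simp add: c(2))
    also have "(\<Sum>j=1..M. f j * (w j * (1 + s * lam j * kt j))) = (\<Sum>j=1..M. f j * \<mu> j) +
        s * (\<Sum>j=2..M-1. lam j * w j * (qu j * f (j+1) + qd j * f (j-1) - f j))"
      by (intro balance_test lam0 bal)
    also have "(\<Sum>j=1..M. f j * \<mu> j) = f (l-1) * \<mu> (l-1) + f l * \<mu> l"
      using l(1,2) by (intro sum_two_points) auto
    finally show ?thesis by (simp add: distrib_left mult.assoc)
  qed
  have lin: "(\<Sum>j=1..M. (kap j - d) * v j) = c * ((kap (l-1) - d) * \<mu> (l-1) + (kap l - d) * \<mu> l)" for d
  proof -
    have "qu j * (kap (j+1) - d) + qd j * (kap (j-1) - d) - (kap j - d) = 0" if "j \<in> {2..M-1}" for j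
    proof -
      have "qu j * (kap (j+1) - d) + qd j * (kap (j-1) - d) - (kap j - d) =
          (qu j * kap (j+1) + qd j * kap (j-1) - kap j) - d * (qu j + qd j - 1)"
        by (simp add: algebra_simps)
      then show ?thesis using kap_martingale[OF that] qu_qd[OF that] by simp
    qed
    then show ?thesis unfolding test by simp
  qed
  have kl: "kap (l-1) < kap l" using l(1) by (rule kap_less)
  have "0 < (\<Sum>j=1..M. (kap j - kap (l-1)) * v j)"
    unfolding lin using kl l c by simp
  then have 1: "left_moment kap v (l-1) < right_moment M kap v (l-1)"
    using sum_about_eq_moments[of "l-1" M kap v] l(1) by force
  have "(\<Sum>j=1..M. (kap j - kap l) * v j) \<le> 0"
    unfolding lin using kl l c by (simp add: mult_le_0_iff)
  then have 2: "right_moment M kap v l \<le> left_moment kap v l"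
    using sum_about_eq_moments[of l M kap v] l(1) by force
  \<comment> \<open>the test functions of the next two steps are linear in \<open>kap\<close> except for a kink at \<open>j\<close>\<close>
  have 3: "left_moment kap v j = c * s * (lam j * w j * (qd j * (kap j - kap (j-1))))"
    if j: "j \<in> {2..M-1}" "j \<le> l - 1" for j
  proof -
    define f where "f a = (if a < j then kap j - kap a else 0)" for a
    have "left_moment kap v j = (\<Sum>a=1..M. f a * v a)"
      unfolding left_moment_def using j by (intro sum.mono_neutral_cong_left) (auto simp: f_def)
    also have "\<dots> = c * s * (\<Sum>i=2..M-1. lam i * w i * (qu i * f (i+1) + qd i * f (i-1) - f i))"
      unfolding test using j by (auto simp: f_def)
    also have "(\<Sum>i=2..M-1. lam i * w i * (qu i * f (i+1) + qd i * f (i-1) - f i)) =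
        (\<Sum>i=2..M-1. lam i * w i * (qd i * (kap i - kap (i-1))) * (if i = j then 1 else 0))"
    proof (intro sum.cong refl)
      fix i assume i: "i \<in> {2..M-1}"
      consider "i < j" | "i = j" | "j < i" by linarith
      then have "qu i * f (i+1) + qd i * f (i-1) - f i = (qd i * (kap i - kap (i-1))) * (if i = j then 1 else 0)"
      proof cases
        case 1
        then have "f (i+1) = kap j - kap (i+1)" by (cases "i + 1 = j") (auto simp: f_def)
        moreover have "f (i-1) = kap j - kap (i-1)" "f i = kap j - kap i" using 1 i by (auto simp: f_def)
        ultimately have "qu i * f (i+1) + qd i * f (i-1) - f i =
            kap j * (qu i + qd i - 1) - (qu i * kap (i+1) + qd i * kap (i-1) - kap i)"
          by (simp only:) (simp add: algebra_simps)
        then show ?thesis using 1 kap_martingale[OF i] qu_qd[OF i] by simp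
      qed (use i in \<open>auto simp: f_def\<close>)
      then show "lam i * w i * (qu i * f (i+1) + qd i * f (i-1) - f i) =
          lam i * w i * (qd i * (kap i - kap (i-1))) * (if i = j then 1 else 0)"
        by (simp only: mult.assoc)
    qed
    also have "\<dots> = lam j * w j * (qd j * (kap j - kap (j-1)))"
      by (rule sum_mult_indicator[OF j(1)])
    finally show ?thesis .
  qed
  have 4: "right_moment M kap v j = c * s * (lam j * w j * (qu j * (kap (j+1) - kap j)))"
    if j: "j \<in> {2..M-1}" "\<not> j \<le> l - 1" for j
  proof -
    define f where "f a = (if j < a then kap a - kap j else 0)" for a
    have "right_moment M kap v j = (\<Sum>a=1..M. f a * v a)"
      unfolding right_moment_def using j by (intro sum.mono_neutral_cong_left) (auto simp: f_def)
    also have "\<dots> = c * s * (\<Sum>i=2..M-1. lam i * w i * (qu i * f (i+1) + qd i * f (i-1) - f i))"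
      unfolding test using j by (auto simp: f_def)
    also have "(\<Sum>i=2..M-1. lam i * w i * (qu i * f (i+1) + qd i * f (i-1) - f i)) =
        (\<Sum>i=2..M-1. lam i * w i * (qu i * (kap (i+1) - kap i)) * (if i = j then 1 else 0))"
    proof (intro sum.cong refl)
      fix i assume i: "i \<in> {2..M-1}"
      consider "i < j" | "i = j" | "j < i" by linarith
      then have "qu i * f (i+1) + qd i * f (i-1) - f i = (qu i * (kap (i+1) - kap i)) * (if i = j then 1 else 0)"
      proof cases
        case 3
        then have "f (i-1) = kap (i-1) - kap j" by (cases "i - 1 = j") (auto simp: f_def)
        moreover have "f (i+1) = kap (i+1) - kap j" "f i = kap i - kap j" using 3 i by (auto simp: f_def)
        ultimately have "qu i * f (i+1) + qd i * f (i-1) - f i =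
            (qu i * kap (i+1) + qd i * kap (i-1) - kap i) - kap j * (qu i + qd i - 1)"
          by (simp only:) (simp add: algebra_simps)
        then show ?thesis using 3 kap_martingale[OF i] qu_qd[OF i] by simp
      qed (use i in \<open>auto simp: f_def\<close>)
      then show "lam i * w i * (qu i * f (i+1) + qd i * f (i-1) - f i) =
          lam i * w i * (qu i * (kap (i+1) - kap i)) * (if i = j then 1 else 0)"
        by (simp only: mult.assoc)
    qed
    also have "\<dots> = lam j * w j * (qu j * (kap (j+1) - kap j))"
      by (rule sum_mult_indicator[OF j(1)])
    finally show ?thesis .
  qed
  have 5: "lam j = 1 / (s * \<pi> j) *
      ((kap (j+1) - kap (j-1)) / ((kap (j+1) - kap j) * (kap j - kap (j-1)))) *
      (if j \<le> l - 1 then left_moment kap v j else right_moment M kap v j)"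
    if j: "j \<in> {2..M-1}" for j
  proof -
    have j1: "j \<in> {1..M}" using j by auto
    have "(if j \<le> l - 1 then left_moment kap v j else right_moment M kap v j) =
        c * s * (lam j * w j * ((kap (j+1) - kap j) * (kap j - kap (j-1)) / (kap (j+1) - kap (j-1))))"
      using 3[OF j] 4[OF j] by (simp add: qu[OF j] qd[OF j] mult_ac)
    then show ?thesis
      using kap_interior[OF j] c(1) s w[OF j1] by (simp add: c(2)[OF j1])
  qed
  have "\<forall>j\<in>{1..M}. 0 < \<pi> j" "\<forall>j\<in>{1..M}. 0 \<le> kt j" using c w kt_nonneg by auto
  then show ?thesis
    using lam l(1) 1 2 5 M unfolding v_def
    by (subst G_system_iff[of s M \<pi> kt, OF s]) auto
qed

end

context killed_chain_ratio
begin

lemma matching_rates: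
  fixes r :: nat and p :: "nat \<Rightarrow> real"
  assumes r: "r \<ge> 1" and p: "\<And>j. j \<in> {1..M} \<Longrightarrow> 0 < p j" "(\<Sum>j=1..M. p j) = 1"
  obtains lam w Y \<mu> S l where "lam \<in> rate_vectors M" "0 < S"
    "\<And>j. j \<in> {1..M} \<Longrightarrow> 0 < w j"
    "\<And>j. j \<in> {1..M} \<Longrightarrow> w j + s * gen (\<lambda>i. lam i * w i) j = \<mu> j"
    "l \<in> {2..M}" "\<And>j. j \<noteq> l - 1 \<Longrightarrow> j \<noteq> l \<Longrightarrow> \<mu> j = 0" "0 \<le> \<mu> (l-1)" "0 < \<mu> l"
    "\<And>j. j \<in> {1..M} \<Longrightarrow> Y 1 j * (1 + s * lam j * kt j) = w j"
    "\<And>n j. 1 \<le> n \<Longrightarrow> n < r \<Longrightarrow> j \<in> {1..M} \<Longrightarrow> Y (Suc n) j + s * gen (\<lambda>i. lam i * Y (Suc n) i) j = Y n j"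
    "\<And>j. j \<in> {1..M} \<Longrightarrow> Y r j = S * p j"
    "\<And>n j. n \<le> r \<Longrightarrow> j \<in> {1..M} \<Longrightarrow> 0 \<le> Y n j"
proof -
  obtain x S where S: "0 < S" and m: "1 < x (0, 0)" "x (0, 0) \<le> real M"
    and tau: "\<And>j. j \<in> {2..M-1} \<Longrightarrow> 0 < x (0, j)"
    and st: "\<And>n. n < r \<Longrightarrow> step (law x n) (occ x (Suc n)) (law x (Suc n))"
    and eq: "\<And>n j. n < r \<Longrightarrow> j \<in> {2..M-1} \<Longrightarrow> law x n j - s * gen (occ x (Suc n)) j = x (0, j) * occ x (Suc n) j"
    and fin: "\<And>j. j \<in> {1..M} \<Longrightarrow> law x r j = S * p j"
  proof (rule matching_occupations[of r p, OF r], goal_cases)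
    case (3 x S)
    from 3(2-) show ?case by (rule 3(1))
  qed (rule p(1), assumption, rule p(2))
  define lam where "lam j = (if j \<in> {2..M-1} then 1 / x (0, j) else 0)" for j
  define W where "W n j = law x n j - s * gen (occ x (Suc n)) j" for n j
  have lam: "lam \<in> rate_vectors M"
    using tau by (auto simp: rate_vectors_def lam_def less_imp_le)
  have occW: "occ x (Suc n) = (\<lambda>j. lam j * W n j)" if "n < r" for n
  proof
    fix j
    show "occ x (Suc n) j = lam j * W n j"
    proof (cases "j \<in> {2..M-1}")
      case True
      then show ?thesis using eq[OF that True] tau[OF True] unfolding W_def lam_def by simp
    next
      case False
      then show ?thesis unfolding lam_def occ_def by (simp only: if_False mult_zero_left)
    qed
  qed
  have balW: "W n j + s * gen (\<lambda>i. lam i * W n i) j = law x n j" if "n < r" for n j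
    unfolding occW[OF that, symmetric] by (simp add: W_def)
  have lawW: "law x (Suc n) = W n" if "1 \<le> n" "n < r" for n
  proof
    fix j
    show "law x (Suc n) j = W n j"
    proof (cases "j \<in> {2..M-1}")
      case True
      then show ?thesis using eq[OF that(2) True] that(1) by (simp add: W_def occ_def)
    next
      case False
      then show ?thesis unfolding law.simps W_def by (simp only: if_False)
    qed
  qed
  have nonneg: "0 \<le> law x n j" if "n \<le> r" "j \<in> {1..M}" for n j
  proof (cases n)
    case (Suc n')
    then have "step (law x n') (occ x (Suc n')) (law x n)" using st[of n'] that by simp
    then show ?thesis using that(2) unfolding step_def by blast
  qed (simp add: hat_nonneg)
  have st0: "step (law x 0) (occ x 1) (law x 1)" using st[of 0] r by simp
  then have z: "\<And>j. 0 \<le> occ x 1 j" "\<And>j. j \<notin> {2..M-1} \<Longrightarrow> occ x 1 j = 0" by (auto simp: step_def)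
  have occ_nz: "occ x 1 j0 \<noteq> 0" if j0: "j0 \<in> {2..M-1}" for j0
  proof
    assume 0: "occ x 1 j0 = 0"
    have z0: "occ x 1 j = 0" for j
    proof (rule zero_propagates[of "occ x 1" j0 j])
      fix i assume i: "i \<in> {2..M-1}" "occ x 1 i = 0"
      have "0 \<le> law x 0 i" by (simp add: hat_nonneg)
      moreover have "law x 0 i = s * gen (occ x 1) i"
        using eq[of 0 i] i r by (simp del: law.simps)
      ultimately show "0 \<le> gen (occ x 1) i" using s by (simp add: zero_le_mult_iff)
    qed (rule z(1), erule z(2), rule j0, rule 0)
    have l1: "law x (Suc n) j = 0" if "n < r" "j \<in> {2..M-1}" for n j
      using that
    proof (induction n arbitrary: j)
      case 0
      have "x (Suc 0, j) = 0" using z0[of j] 0 by (simp add: occ_def)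
      then show ?case using 0 by simp
    next
      case (Suc n)
      have j: "j \<in> {1..M}" using Suc.prems by auto
      have "law x (Suc (Suc n)) j = law x (Suc n) j"
        using Suc by (intro step_frozen[OF st[OF Suc.prems(1)] _ _ j] nonneg) (auto simp del: law.simps)
      then show ?case using Suc by (simp del: law.simps)
    qed
    have "law x r 2 = 0" using l1[of "r - 1" 2] r M by (simp del: law.simps)
    moreover have "0 < S * p 2" using S p(1)[of 2] M by simp
    moreover have "law x r 2 = S * p 2" using M by (intro fin) auto
    ultimately show False by linarith
  qed
  have occ_pos: "0 < occ x 1 j" if "j \<in> {2..M-1}" for j
    using occ_nz[OF that] z(1)[of j] by simp
  have wpos: "0 < W 0 j" if j: "j \<in> {1..M}" for j
  proof -
    consider "j \<in> {2..M-1}" | "j = 1" | "j = M" using j by fastforce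
    then show ?thesis
    proof cases
      case 1
      then show ?thesis using eq[of 0 j] r tau[OF 1] occ_pos[OF 1] by (simp add: W_def del: law.simps)
    next
      case 2
      have "occ x 1 0 = 0" "occ x 1 1 = 0" by (rule z(2), simp)+
      then have "gen (occ x 1) 1 = - (qd 2 * occ x 1 2)" by (simp add: gen_def numeral_2_eq_2)
      moreover have "0 < qd 2 * occ x 1 2" using M by (intro mult_pos_pos qd_pos occ_pos) auto
      ultimately have "s * gen (occ x 1) 1 < 0" using s by (simp add: mult_less_0_iff)
      then show ?thesis using 2 hat_nonneg[of "x (0, 0)" 1] by (simp add: W_def)
    next
      case 3
      have "M \<notin> {2..M-1}" "M + 1 \<notin> {2..M-1}" using M by auto
      then have "occ x 1 M = 0" "occ x 1 (M+1) = 0" using z(2) by blast+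
      then have "gen (occ x 1) M = - (qu (M-1) * occ x 1 (M-1))" by (simp add: gen_def)
      moreover have "0 < qu (M-1) * occ x 1 (M-1)" using M by (intro mult_pos_pos qu_pos occ_pos) auto
      ultimately have "s * gen (occ x 1) M < 0" using s by (simp add: mult_less_0_iff)
      then show ?thesis using 3 hat_nonneg[of "x (0, 0)" M] by (simp add: W_def)
    qed
  qed
  obtain l where l: "l \<in> {2..M}" "\<forall>j. j \<noteq> l - 1 \<longrightarrow> j \<noteq> l \<longrightarrow> hat (x (0, 0)) j = 0"
    "0 < hat (x (0, 0)) l"
    using hat_support[OF less_imp_le[OF m(1)] m(2)] m(1) by blast
  show thesis
  proof (rule that[of lam S "W 0" "hat (x (0, 0))" l "law x"])
    show "lam \<in> rate_vectors M" "0 < S" "l \<in> {2..M}" "0 < hat (x (0, 0)) l" by fact+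
    show "0 \<le> hat (x (0, 0)) (l-1)" by (rule hat_nonneg)
    show "0 < W 0 j" if "j \<in> {1..M}" for j by (rule wpos[OF that])
    show "W 0 j + s * gen (\<lambda>i. lam i * W 0 i) j = hat (x (0, 0)) j" for j
      using balW[of 0 j] r by simp
    show "hat (x (0, 0)) j = 0" if "j \<noteq> l - 1" "j \<noteq> l" for j using l that by blast
    show "law x 1 j * (1 + s * lam j * kt j) = W 0 j" if "j \<in> {1..M}" for j
    proof (cases "j \<in> {2..M-1}")
      case True
      define u where "u = x (0, j)"
      have u: "0 < u" "0 \<le> s * kt j" using tau[OF True] s kt_nonneg[of j] by (auto simp: u_def)
      then have "0 < u + s * kt j" by linarith
      moreover have "1 + s * lam j * kt j = (u + s * kt j) / u"
        using True u by (simp add: lam_def u_def[symmetric] add_divide_distrib)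
      ultimately have "damp j u * (1 + s * lam j * kt j) = u"
        using u by (simp add: damp_def)
      moreover have "law x 1 j = damp j u * occ x 1 j" using True by (simp add: u_def occ_def)
      moreover have "W 0 j = u * occ x 1 j" using eq[of 0 j] r True by (simp add: W_def u_def del: law.simps)
      ultimately show ?thesis by (simp del: law.simps)
    next
      case False
      then have "law x 1 j = W 0 j" unfolding One_nat_def law.simps(2) W_def by (simp only: if_False)
      moreover have "lam j = 0" using False unfolding lam_def by (simp only: if_False)
      ultimately show ?thesis by simp
    qed
    show "law x (Suc n) j + s * gen (\<lambda>i. lam i * law x (Suc n) i) j = law x n j"
      if "1 \<le> n" "n < r" for n j
      unfolding lawW[OF that] by (rule balW[OF that(2)])
    show "law x r j = S * p j" if "j \<in> {1..M}" for j by (rule fin[OF that])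
    show "0 \<le> law x n j" if "n \<le> r" "j \<in> {1..M}" for n j by (rule nonneg[OF that])
  qed
qed

end

section \<open>The fixed point\<close>

lemma row_times_Nmat:
  assumes lam: "lam \<in> rate_vectors M" and j: "j \<in> {1..M}"
  shows "(\<Sum>i=1..M. y i * Nmat M x b k s lam i j) =
    y j + s * ((1 + ktilde M x k j) * (lam j * y j) - q_up x b (j-1) * (lam (j-1) * y (j-1))
      - q_down x b (j+1) * (lam (j+1) * y (j+1)))"
proof -
  have lam0: "lam i = 0" if "i \<notin> {2..M-1}" for i using lam that by (simp add: rate_vectors_def)
  have "y i * Nmat M x b k s lam i j =
      (if i = j then y j + s * ((1 + ktilde M x k j) * (lam j * y j)) else 0)
      - (if i = j - 1 then s * (q_up x b (j-1) * (lam (j-1) * y (j-1))) else 0)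
      - (if i = j + 1 then s * (q_down x b (j+1) * (lam (j+1) * y (j+1))) else 0)"
    if i: "i \<in> {1..M}" for i
  proof (cases "i = 1 \<or> i = M")
    case True
    then have "lam i = 0" by (intro lam0) auto
    then show ?thesis using True j by (auto simp: Nmat_def)
  next
    case False
    consider "i = j" | "i = j - 1" "i \<noteq> j" | "i = j + 1" | "i \<noteq> j" "i \<noteq> j - 1" "i \<noteq> j + 1" by blast
    then show ?thesis
      using False i j by cases (auto simp: Nmat_def algebra_simps)
  qed
  then have "(\<Sum>i=1..M. y i * Nmat M x b k s lam i j) =
      (\<Sum>i=1..M. if i = j then y j + s * ((1 + ktilde M x k j) * (lam j * y j)) else 0)
      - (\<Sum>i=1..M. if i = j - 1 then s * (q_up x b (j-1) * (lam (j-1) * y (j-1))) else 0)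
      - (\<Sum>i=1..M. if i = j + 1 then s * (q_down x b (j+1) * (lam (j+1) * y (j+1))) else 0)"
    by (simp only: sum_subtractf[symmetric] cong: sum.cong)
  also have "(\<Sum>i=1..M. if i = j then y j + s * ((1 + ktilde M x k j) * (lam j * y j)) else 0) =
      y j + s * ((1 + ktilde M x k j) * (lam j * y j))"
    using j by (subst sum.delta) auto
  also have "(\<Sum>i=1..M. if i = j - 1 then s * (q_up x b (j-1) * (lam (j-1) * y (j-1))) else 0) =
      s * (q_up x b (j-1) * (lam (j-1) * y (j-1)))"
  proof (cases "j - 1 \<in> {1..M}")
    case False
    then have "lam (j-1) = 0" by (intro lam0) auto
    then show ?thesis by simp
  qed (subst sum.delta, auto)
  also have "(\<Sum>i=1..M. if i = j + 1 then s * (q_down x b (j+1) * (lam (j+1) * y (j+1))) else 0) =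
      s * (q_down x b (j+1) * (lam (j+1) * y (j+1)))"
  proof (cases "j + 1 \<in> {1..M}")
    case False
    then have "lam (j+1) = 0" by (intro lam0) auto
    then show ?thesis by simp
  qed (subst sum.delta, auto)
  finally show ?thesis by (simp add: algebra_simps)
qed

lemma mass_scale:
  assumes "\<And>j. j \<in> {1..M} \<Longrightarrow> y j = c * y' j"
  shows "mass M x k s lam y = c * mass M x k s lam y'"
  unfolding mass_def sum_distrib_left using assms by (intro sum.cong) auto

lemma hmap_scale:
  assumes "c \<noteq> 0" "\<And>j. j \<in> {1..M} \<Longrightarrow> y j = c * y' j"
  shows "hmap M x b k s lam y = hmap M x b k s lam y'"
proof
  fix j
  have "(\<Sum>i=1..M. y i * Nmat M x b k s lam i j) = c * (\<Sum>i=1..M. y' i * Nmat M x b k s lam i j)"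
    unfolding sum_distrib_left using assms(2) by (intro sum.cong) auto
  moreover have "mass M x k s lam y = c * mass M x k s lam y'"
    by (rule mass_scale) (rule assms(2))
  ultimately show "hmap M x b k s lam y j = hmap M x b k s lam y' j"
    using assms(1) unfolding hmap_def by simp
qed

theorem theorem9p1:
  fixes M r e :: nat and t theta :: real and x b k p :: "nat \<Rightarrow> real"
  assumes "M \<ge> 3"
    and "t > 0"
    and "r \<ge> 1"
    and "strict_mono_on {1..M} x"
    and "p \<in> \<Delta> M"
    and "\<forall>j\<in>{2..M-1}. - 1 / (x (j+1) - x j) < b j \<and> b j < 1 / (x j - x (j-1))"
    and "\<forall>j\<in>{2..M-1}. 0 \<le> k j"
    and "0 < theta" "theta < 1/2" "e_minus M theta p < e_plus M theta p"
    and "e \<in> {1..M}" "(\<Sum>i=1..e. p i) \<ge> 1/2" "(\<Sum>i=e..M. p i) \<ge> 1/2"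
  shows "\<exists>lam \<in> rate_vectors M.
      Qh_defined M x b k (t / real r) lam (r - 1) p \<and>
      Qvec M x k (t / real r) ((hmap M x b k (t / real r) lam ^^ (r - 1)) p) lam \<in> \<Delta> M \<and>
      (\<forall>j\<in>{2..M-1}. lam j = Amap M x b k t r theta e lam p j)"
proof -
  define s where "s = t / real r"
  define kap where "kap = kappa M x b theta e p"
  define kt where "kt = ktilde M x k"
  define h where "h lam = hmap M x b k s lam" for lam
  have s: "0 < s" using assms(2,3) by (simp add: s_def)
  have p: "0 < p j" if "j \<in> {1..M}" for j using assms(5) that by (simp add: open_simplex_def)
  have sp: "(\<Sum>j=1..M. p j) = 1" using assms(5) by (simp add: open_simplex_def)
  have kt0: "0 \<le> kt j" for j
  proof (cases "j \<in> {2..M-1}")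
    case True
    then have "x (j-1) < x j" "x j < x (j+1)"
      by (intro strict_mono_onD[OF assms(4)]; force)+
    then show ?thesis using True assms(7) by (simp add: kt_def ktilde_def)
  next
    case False
    then show ?thesis unfolding kt_def ktilde_def by (simp only: if_False order_refl)
  qed
  note K = kappa_strict_mono_and_q[where e = e, OF assms(1,4-6,8-10), folded kap_def]
  interpret C: killed_chain M s kap "q_up x b" "q_down x b" kt
  proof
    show "kt j = 0" if "j \<notin> {2..M-1}" for j
      unfolding kt_def ktilde_def using that by (simp only: if_False)
  qed (rule assms(1) s kt0 | erule K)+
  obtain \<eta> where "0 < \<eta>" "\<eta> \<le> 1" "\<And>j. j \<in> {2..M-1} \<Longrightarrow> \<eta> * (2 + 2 * kt j) \<le> q_up x b j"
    using C.small_ratio by blast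
  then interpret C: killed_chain_ratio M s kap "q_up x b" "q_down x b" kt \<eta>
    by unfold_locales
  obtain lam w Y \<mu> S l where lam: "lam \<in> rate_vectors M" and S: "0 < S"
    and w: "\<And>j. j \<in> {1..M} \<Longrightarrow> 0 < w j"
    and bal: "\<And>j. j \<in> {1..M} \<Longrightarrow> w j + s * C.gen (\<lambda>i. lam i * w i) j = \<mu> j"
    and l: "l \<in> {2..M}" "\<And>j. j \<noteq> l - 1 \<Longrightarrow> j \<noteq> l \<Longrightarrow> \<mu> j = 0" "0 \<le> \<mu> (l-1)" "0 < \<mu> l"
    and Y1: "\<And>j. j \<in> {1..M} \<Longrightarrow> Y 1 j * (1 + s * lam j * kt j) = w j"
    and Ys: "\<And>n j. 1 \<le> n \<Longrightarrow> n < r \<Longrightarrow> j \<in> {1..M} \<Longrightarrow> Y (Suc n) j + s * C.gen (\<lambda>i. lam i * Y (Suc n) i) j = Y n j"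
    and Yr: "\<And>j. j \<in> {1..M} \<Longrightarrow> Y r j = S * p j"
    and Y0: "\<And>n j. n \<le> r \<Longrightarrow> j \<in> {1..M} \<Longrightarrow> 0 \<le> Y n j"
  proof (rule C.matching_rates[of r p, OF assms(3)], goal_cases)
    case 3
    from 3(2-) show ?case by (rule 3(1))
  qed (rule p, assumption, rule sp)
  have lam0: "0 \<le> lam j" for j using lam by (cases "j \<in> {2..M-1}") (auto simp: rate_vectors_def)
  have lamo: "lam j = 0" if "j \<notin> {2..M-1}" for j using lam that by (simp add: rate_vectors_def)
  have massE: "mass M x k s lam y = (\<Sum>j=1..M. y j * (1 + s * lam j * kt j))" for y
    by (simp add: mass_def kt_def)
  have NE: "(\<Sum>i=1..M. y i * Nmat M x b k s lam i j) = y j + s * C.gen (\<lambda>i. lam i * y i) j"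
    if "j \<in> {1..M}" for y j
    unfolding row_times_Nmat[OF lam that] C.gen_def by (simp only: kt_def)
  have massY: "mass M x k s lam (Y (Suc n)) = (\<Sum>j=1..M. Y n j)" if "1 \<le> n" "n < r" for n
    unfolding massE by (rule C.balance_mass) (use lamo Ys that in auto)
  have mass_ge: "(\<Sum>j=1..M. Y n j) \<le> mass M x k s lam (Y n)" if "n \<le> r" for n
    unfolding massE
  proof (intro sum_mono)
    fix j assume j: "j \<in> {1..M}"
    have "0 \<le> s * lam j * kt j" using s lam0 kt0 by simp
    then show "Y n j \<le> Y n j * (1 + s * lam j * kt j)"
      using Y0[OF that j] mult_left_mono[of 1 "1 + s * lam j * kt j" "Y n j"] by simp
  qed
  have "(\<Sum>j=1..M. Y r j) = S * (\<Sum>j=1..M. p j)"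
    unfolding sum_distrib_left by (intro sum.cong refl Yr)
  then have sumYr: "(\<Sum>j=1..M. Y r j) = S" using sp by simp
  have iter: "0 < (\<Sum>j=1..M. Y (r - m) j) \<and>
      (\<forall>j\<in>{1..M}. (h lam ^^ m) p j = 1 / (\<Sum>j=1..M. Y (r - m) j) * Y (r - m) j)"
    if "m \<le> r - 1" for m
    using that
  proof (induction m)
    case 0
    show ?case using sumYr S Yr by simp
  next
    case (Suc m)
    define n where "n = r - Suc m"
    have n: "1 \<le> n" "n < r" "r - m = Suc n" using Suc.prems by (auto simp: n_def)
    define c where "c = 1 / (\<Sum>j=1..M. Y (Suc n) j)"
    have IH: "0 < (\<Sum>j=1..M. Y (Suc n) j)" "\<forall>j\<in>{1..M}. (h lam ^^ m) p j = c * Y (Suc n) j"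
      using Suc n by (auto simp: c_def)
    have pos: "0 < (\<Sum>j=1..M. Y n j)"
      using mass_ge[of "Suc n"] massY[OF n(1,2)] IH(1) n by simp
    have "(h lam ^^ Suc m) p = h lam (Y (Suc n))"
      using IH by (simp add: h_def) (rule hmap_scale[of c], auto simp: c_def)
    moreover have "h lam (Y (Suc n)) j = 1 / (\<Sum>j=1..M. Y n j) * Y n j" if "j \<in> {1..M}" for j
      unfolding h_def hmap_def massY[OF n(1,2)] NE[OF that] Ys[OF n(1,2) that] ..
    ultimately show ?case using pos by (simp add: n_def)
  qed
  have Yw: "mass M x k s lam (Y 1) = (\<Sum>j=1..M. w j)"
    unfolding massE by (intro sum.cong refl Y1)
  define c where "c = 1 / (\<Sum>j=1..M. w j)"
  have W: "0 < (\<Sum>j=1..M. w j)" using assms(1) by (intro sum_pos w) auto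
  then have c: "0 < c" by (simp add: c_def)
  define \<pi> where "\<pi> = Qvec M x k s ((h lam ^^ (r - 1)) p) lam"
  have \<pi>: "\<pi> j = c * w j" if j: "j \<in> {1..M}" for j
  proof -
    define d where "d = 1 / (\<Sum>j=1..M. Y 1 j)"
    have r1: "r - (r - 1) = 1" using assms(3) by simp
    have d: "0 < d" "\<And>j. j \<in> {1..M} \<Longrightarrow> (h lam ^^ (r - 1)) p j = d * Y 1 j"
      using iter[of "r - 1"] unfolding r1 by (auto simp: d_def)
    have "mass M x k s lam ((h lam ^^ (r - 1)) p) = d * mass M x k s lam (Y 1)"
      by (rule mass_scale) (rule d(2))
    then have "\<pi> j = d * Y 1 j * (1 + s * kt j * lam j) / (d * (\<Sum>j=1..M. w j))"
      unfolding \<pi>_def Qvec_def by (simp only: Yw kt_def d(2)[OF j])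
    also have "\<dots> = Y 1 j * (1 + s * lam j * kt j) / (\<Sum>j=1..M. w j)"
      using d(1) by (simp add: mult_ac)
    finally show ?thesis unfolding Y1[OF j] by (simp add: c_def)
  qed
  have pi_pos: "\<forall>j\<in>{1..M}. 0 < \<pi> j" using \<pi> c w by simp
  have pi_sum: "(\<Sum>j=1..M. \<pi> j) = 1"
  proof -
    have "(\<Sum>j=1..M. \<pi> j) = c * (\<Sum>j=1..M. w j)" unfolding sum_distrib_left by (intro sum.cong refl \<pi>)
    then show ?thesis using W by (simp add: c_def)
  qed
  have "\<pi> j < 1" if j: "j \<in> {1..M}" for j
  proof -
    define i where "i = (if j = 1 then 2 else 1 :: nat)"
    have i: "i \<in> {1..M}" "i \<noteq> j" using assms(1) by (auto simp: i_def)
    have "(\<Sum>a\<in>{i, j}. \<pi> a) \<le> (\<Sum>a=1..M. \<pi> a)"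
      using i j pi_pos by (intro sum_mono2) (auto intro: less_imp_le)
    then show ?thesis using i pi_sum bspec[OF pi_pos i(1)] by simp
  qed
  then have pi_simplex: "\<pi> \<in> \<Delta> M" using pi_pos pi_sum by (simp add: open_simplex_def)
  have sys: "G_system M kap kt s \<pi> lam"
    by (rule C.G_system_of_balance[OF lam w bal l c \<pi>])
  have "Gvec M kap kt s \<pi> = lam"
    unfolding Gvec_def
  proof (rule the_equality)
    show "G_system M kap kt s \<pi> lam" by (rule sys)
    fix g assume "G_system M kap kt s \<pi> g"
    then show "g = lam"
      using s pi_pos kt0 assms(1) C.kap_mono sys by (intro G_system_unique[of s M \<pi> kt kap]) auto
  qed
  then have A: "lam j = Amap M x b k t r theta e lam p j" for j
    by (simp add: Amap_def \<pi>_def kap_def kt_def s_def h_def)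
  have "mass M x k s lam ((h lam ^^ m) p) \<noteq> 0" if m: "m \<le> r - 1" for m
  proof -
    have "mass M x k s lam ((h lam ^^ m) p) =
        1 / (\<Sum>j=1..M. Y (r - m) j) * mass M x k s lam (Y (r - m))"
      using iter[OF m] by (intro mass_scale) blast
    moreover have "0 < (\<Sum>j=1..M. Y (r - m) j)" using iter[OF m] by blast
    moreover have "(\<Sum>j=1..M. Y (r - m) j) \<le> mass M x k s lam (Y (r - m))" by (rule mass_ge) simp
    ultimately show ?thesis by simp
  qed
  then have "Qh_defined M x b k (t / real r) lam (r - 1) p"
    by (simp add: Qh_defined_def h_def s_def)
  with lam A pi_simplex show ?thesis
    unfolding \<pi>_def h_def s_def by blast
qed

end
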